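(* Let $m\ge2$, let $h$ be a positive integer and let $\lambda=(\lambda_1,\ldots,\lambda_m)$ be a partition with $\lambda_m=0$. The Newton polytope $\mathrm{Newt}(G_{h,\lambda}(x_1,\ldots,x_m))$ is reflexive if and only if $(h,\lambda)$ is one of the following: $h\ge1$ and $\lambda=(2,\ldots,2,0,\ldots,0)$, a partition of $m-1$ with $m$ parts, for odd $m\ge3$; $h\ge1$ and $\lambda=(2,\ldots,2,1,0,\ldots,0)$, a partition of $m-1$ with $m$ parts, for even $m\ge4$; $h\ge2$ and $\lambda=(m+1,\ldots,m+1,0)$ (with $m-1$ entries $m+1$), a partition of $m^2-1$, for $m\ge2$; $h=1$ and $\lambda=(4,4,0)$ (so $m=3$).
   Context: $\mathrm{Newt}(f)$ is the convex hull of exponent vectors of monomials with nonzero coefficient in $f$. Schur polynomial $s_\mu(x_1,\ldots,x_m)=\sum_T\mathbf{x}^T$ over semistandard Young tableaux of shape $\mu$ with entries in $\{1,\ldots,m\}$. For a partition $\mu\supseteq\lambda$ with at most $m$ rows, $b_{h,\lambda\mu}$ is the number of fillings of $\mu/\lambda$ with positive integers strictly increasing along rows and columns, entries in row $r$ from $\{1,\ldots,h(r-1)\}$; $A(h,\lambda)=\{\mu\mid b_{h,\lambda\mu}\ne0\}$; $G_{h,\lambda}=\sum_{\mu\in A(h,\lambda)}(-1)^{|\mu/\lambda|}b_{h,\lambda\mu}s_\mu$. A lattice polytope $\mathcal{P}$ is reflexive if there is a lattice point $\mathbf{p}$ in its (relative) interior at lattice distance $1$ from every facet, i.e. for each facet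 $F$ there are no lattice points of $\mathrm{aff}(\mathcal{P})$ strictly between the affine span of $F$ and its parallel translate through $\mathbf{p}$.
   Formalization: The partition λ = (0,…,0) is excluded: there G = 1 and the Newton polytope is a single lattice point, which is vacuously reflexive although (0,…,0) is not in the list. *)

theory Defs
  imports "HOL-Analysis.Analysis" "HOL-Library.Poly_Mapping"
begin

text \<open>
  A partition with at most \<open>m\<close> rows is a weakly decreasing list of length \<open>m\<close>, padded with zeros.
  The rows and columns of diagrams are numbered from \<open>0\<close>, so row \<open>r\<close> here is usually
  called row \<open>r + 1\<close>.
\<close>

definition is_partition :: "nat list \<Rightarrow> bool" where
  "is_partition mu \<longleftrightarrow> sorted_wrt (\<ge>) mu"

definition diagram :: "nat list \<Rightarrow> (nat \<times> nat) set" where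
  "diagram mu = {(r, c). r < length mu \<and> c < mu ! r}"

abbreviation skew_diagram :: "nat list \<Rightarrow> nat list \<Rightarrow> (nat \<times> nat) set" where
  "skew_diagram lam mu \<equiv> diagram mu - diagram lam"


text \<open>
  Polynomials with integer coefficients in the variables \<open>x\<^sub>i\<close>, where \<open>i\<close> ranges over \<open>'n\<close>.
  The linearly ordered finite type \<open>'n\<close> with \<open>m\<close> elements plays the role of \<open>{1,\<dots>,m}\<close>.
\<close>

type_synonym 'n int_mpoly = "('n \<Rightarrow>\<^sub>0 nat) \<Rightarrow>\<^sub>0 int"

definition mvar :: "'n \<Rightarrow> 'n int_mpoly" where
  "mvar i = Poly_Mapping.single (Poly_Mapping.single i 1) 1"

text \<open>
  Tableaux and fillings are functions on cells that are \<open>undefined\<close> outside their shape, so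
  that each of them is represented by exactly one function.
\<close>

definition ssyt :: "nat list \<Rightarrow> (nat \<times> nat \<Rightarrow> 'n::linorder) set" where
  "ssyt mu = {T \<in> diagram mu \<rightarrow>\<^sub>E UNIV.
     (\<forall>r c c'. (r, c) \<in> diagram mu \<and> (r, c') \<in> diagram mu \<and> c < c' \<longrightarrow> T (r, c) \<le> T (r, c')) \<and>
     (\<forall>r r' c. (r, c) \<in> diagram mu \<and> (r', c) \<in> diagram mu \<and> r < r' \<longrightarrow> T (r, c) < T (r', c))}"

definition schur :: "nat list \<Rightarrow> ('n::{finite,linorder}) int_mpoly" where
  "schur mu = (\<Sum>T\<in>ssyt mu. \<Prod>p\<in>diagram mu. mvar (T p))"

definition fillings :: "nat \<Rightarrow> nat list \<Rightarrow> nat list \<Rightarrow> (nat \<times> nat \<Rightarrow> nat) set" where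
  "fillings h lam mu = {f \<in> (\<Pi>\<^sub>E (r, c) \<in> skew_diagram lam mu. {1..h * r}).
     (\<forall>r c c'. (r, c) \<in> skew_diagram lam mu \<and> (r, c') \<in> skew_diagram lam mu \<and> c < c'
        \<longrightarrow> f (r, c) < f (r, c')) \<and>
     (\<forall>r r' c. (r, c) \<in> skew_diagram lam mu \<and> (r', c) \<in> skew_diagram lam mu \<and> r < r'
        \<longrightarrow> f (r, c) < f (r', c))}"

definition b_coeff :: "nat \<Rightarrow> nat list \<Rightarrow> nat list \<Rightarrow> nat" where
  "b_coeff h lam mu = card (fillings h lam mu)"

definition A_set :: "nat \<Rightarrow> nat list \<Rightarrow> nat list set" where
  "A_set h lam = {mu. is_partition mu \<and> length mu = length lam \<and> diagram lam \<subseteq> diagram mu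
     \<and> b_coeff h lam mu \<noteq> 0}"

definition G_poly :: "nat \<Rightarrow> nat list \<Rightarrow> ('n::{finite,linorder}) int_mpoly" where
  "G_poly h lam = (\<Sum>mu\<in>A_set h lam.
     (-1) ^ card (skew_diagram lam mu) * of_nat (b_coeff h lam mu) * schur mu)"

text \<open>The sums and cardinalities above are over finite sets.\<close>

lemma finite_diagram [simp]: "finite (diagram mu)"
proof -
  have "diagram mu = (SIGMA r : {..<length mu}. {..<mu ! r})"
    by (auto simp: diagram_def)
  then show ?thesis by simp
qed

lemma finite_ssyt: "finite (ssyt mu :: (nat \<times> nat \<Rightarrow> 'n::{finite,linorder}) set)"
proof -
  have "finite (diagram mu \<rightarrow>\<^sub>E (UNIV :: 'n set))"
    by (intro finite_PiE) auto
  then show ?thesis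
    unfolding ssyt_def by (rule rev_finite_subset) auto
qed

lemma finite_fillings: "finite (fillings h lam mu)"
proof -
  have "finite (\<Pi>\<^sub>E (r, c) \<in> skew_diagram lam mu. {1..h * r})"
    by (intro finite_PiE) auto
  then show ?thesis
    unfolding fillings_def by (rule rev_finite_subset) auto
qed

lemma finite_A_set: "finite (A_set h lam)"
proof -
  let ?K = "\<Sum>r<length lam. lam ! r + h * r"
  have "A_set h lam \<subseteq> {mu. set mu \<subseteq> {..?K} \<and> length mu = length lam}"
  proof
    fix mu assume mu: "mu \<in> A_set h lam"
    then have len: "length mu = length lam" by (simp add: A_set_def)
    from mu have "fillings h lam mu \<noteq> {}" by (auto simp: A_set_def b_coeff_def)
    then obtain f where f: "f \<in> fillings h lam mu" by blast
    have "mu ! r \<le> ?K" if r: "r < length lam" for r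
    proof -
      have cell: "(r, c) \<in> skew_diagram lam mu \<longleftrightarrow> lam ! r \<le> c \<and> c < mu ! r" for c
        using r len by (auto simp: diagram_def)
      have "inj_on (\<lambda>c. f (r, c)) {lam ! r..<mu ! r}"
      proof (rule linorder_inj_onI')
        fix c c' assume "c \<in> {lam ! r..<mu ! r}" "c' \<in> {lam ! r..<mu ! r}" "c < c'"
        then have "f (r, c) < f (r, c')"
          using f cell unfolding fillings_def by auto
        then show "f (r, c) \<noteq> f (r, c')" by simp
      qed
      moreover have "(\<lambda>c. f (r, c)) ` {lam ! r..<mu ! r} \<subseteq> {1..h * r}"
      proof
        fix y assume "y \<in> (\<lambda>c. f (r, c)) ` {lam ! r..<mu ! r}"
        then obtain c where c: "(r, c) \<in> skew_diagram lam mu" "y = f (r, c)"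
          using cell by auto
        have "f \<in> (\<Pi>\<^sub>E (r, c) \<in> skew_diagram lam mu. {1..h * r})"
          using f by (simp add: fillings_def)
        from PiE_mem[OF this c(1)] show "y \<in> {1..h * r}" using c(2) by simp
      qed
      ultimately have "card {lam ! r..<mu ! r} \<le> card {1..h * r}"
        by (intro card_inj_on_le) auto
      then have "mu ! r \<le> lam ! r + h * r" by simp
      also have "\<dots> \<le> ?K"
        using r by (intro member_le_sum[where f = "\<lambda>r. lam ! r + h * r"]) auto
      finally show ?thesis .
    qed
    then show "mu \<in> {mu. set mu \<subseteq> {..?K} \<and> length mu = length lam}"
      using len by (auto simp: in_set_conv_nth)
  qed
  moreover have "finite {mu. set mu \<subseteq> {..?K} \<and> length mu = length lam}"
    by (rule finite_lists_length_eq) simp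
  ultimately show ?thesis by (rule finite_subset)
qed


definition exponent_vector :: "('n \<Rightarrow>\<^sub>0 nat) \<Rightarrow> real ^ 'n" where
  "exponent_vector a = (\<chi> i. real (Poly_Mapping.lookup a i))"

definition Newt :: "('n::finite) int_mpoly \<Rightarrow> (real ^ 'n) set" where
  "Newt f = convex hull (exponent_vector ` Poly_Mapping.keys f)"

definition lattice_points :: "(real ^ 'n) set" where
  "lattice_points = {x. \<forall>i. x $ i \<in> \<int>}"

definition lattice_polytope :: "(real ^ 'n::finite) set \<Rightarrow> bool" where
  "lattice_polytope P \<longleftrightarrow> (\<exists>V. finite V \<and> V \<subseteq> lattice_points \<and> P = convex hull V)"

text \<open>
  The points strictly between the affine span of \<open>F\<close> and its parallel translate through \<open>p\<close>.
\<close>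

definition parallel_through :: "(real ^ 'n::finite) \<Rightarrow> (real ^ 'n) set \<Rightarrow> (real ^ 'n) set" where
  "parallel_through p F = {a + (p - q) |a q. a \<in> affine hull F \<and> q \<in> affine hull F}"

definition strictly_between :: "(real ^ 'n::finite) \<Rightarrow> (real ^ 'n) set \<Rightarrow> (real ^ 'n) set" where
  "strictly_between p F = (\<Union>a\<in>affine hull F. \<Union>b\<in>parallel_through p F. open_segment a b)"

text \<open>
  The point \<open>p\<close> lies in the relative interior of \<open>P\<close>, hence never in \<open>affine hull F\<close>; so being at
  lattice distance at most one from \<open>F\<close> is the same as being at lattice distance one.
\<close>

definition reflexive :: "(real ^ 'n::finite) set \<Rightarrow> bool" where
  "reflexive P \<longleftrightarrow> lattice_polytope P \<and>
     (\<exists>p \<in> lattice_points \<inter> rel_interior P. \<forall>F. F facet_of P \<longrightarrow>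
        lattice_points \<inter> affine hull P \<inter> strictly_between p F = {})"

end

theory Submission
  imports Defs
begin

text \<open>
  The shapes in \<open>G\<close> are all partitions between \<open>\<lambda>\<close> and the partition \<open>M\<close> with
  \<open>M\<^sub>r = min\<^sub>i\<^sub>\<le>\<^sub>r (\<lambda>\<^sub>i + h i)\<close>. Terms of equal degree have equal sign, so the vertices of the Newton
  polytope are the permutations of \<open>(M\<^sub>0,\<dots>,M\<^sub>k\<^sub>-\<^sub>1,\<lambda>\<^sub>k,\<dots>)\<close>, and summation by parts shows that it is cut
  out by inequalities \<open>L(|S|) \<le> x(S) \<le> U(|S|)\<close>, with \<open>x(S)\<close> the sum of the coordinates in \<open>S\<close>. The facets
  \<open>x\<^sub>i \<le> \<lambda>\<^sub>0\<close> force the interior point to be \<open>(c,\<dots>,c)\<close> with \<open>c = \<lambda>\<^sub>0 - 1\<close>, and the remaining facets give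
  equations \<open>U(s) = sc + 1\<close> and \<open>L(s) = sc - 1\<close>. If \<open>x\<^sub>i \<ge> 0\<close> is a facet then \<open>c = 1\<close>; otherwise
  all parts but the last are equal.
\<close>

subsection \<open>The shapes that occur in \<open>G\<close>\<close>

definition cap :: "nat \<Rightarrow> nat list \<Rightarrow> nat \<Rightarrow> nat" where
  "cap h lam r = Min ((\<lambda>i. lam ! i + h * i) ` {..r})"

lemma cap_le: "i \<le> r \<Longrightarrow> cap h lam r \<le> lam ! i + h * i"
  by (simp add: cap_def)

lemma le_cap_iff: "k \<le> cap h lam r \<longleftrightarrow> (\<forall>i\<le>r. k \<le> lam ! i + h * i)"
  by (auto simp: cap_def)

lemma cap_0 [simp]: "cap h lam 0 = lam ! 0"
  by (simp add: cap_def)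

lemma cap_antimono: "r \<le> r' \<Longrightarrow> cap h lam r' \<le> cap h lam r"
  by (auto simp: le_cap_iff intro: cap_le)

lemma is_partition_nth:
  assumes "is_partition mu" "i \<le> j" "j < length mu"
  shows "mu ! j \<le> mu ! i"
  using assms sorted_wrt_nth_less[of "(\<ge>)" mu i j]
  by (cases "i = j") (auto simp: is_partition_def)

lemma is_partitionI:
  assumes "\<And>i j. i < j \<Longrightarrow> j < length mu \<Longrightarrow> mu ! j \<le> mu ! i"
  shows "is_partition mu"
  using assms by (auto simp: is_partition_def sorted_wrt_iff_nth_less)

lemma le_cap:
  assumes "is_partition lam" "r < length lam"
  shows "lam ! r \<le> cap h lam r"
  unfolding le_cap_iff using assms by (meson is_partition_nth trans_le_add1)

text \<open>The new cells of row \<open>r\<close> carry distinct entries from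
  \<open>{1..h * r}\<close>, so there are at most \<open>h * r\<close> of them.\<close>

lemma fillings_row_bound:
  assumes f: "f \<in> fillings h lam mu" and r: "r < length mu" "length mu = length lam"
  shows "mu ! r \<le> lam ! r + h * r"
proof -
  have cell: "(r, c) \<in> skew_diagram lam mu \<longleftrightarrow> lam ! r \<le> c \<and> c < mu ! r" for c
    using r by (auto simp: diagram_def)
  have "inj_on (\<lambda>c. f (r, c)) {lam ! r..<mu ! r}"
  proof (rule linorder_inj_onI')
    fix c c' assume "c \<in> {lam ! r..<mu ! r}" "c' \<in> {lam ! r..<mu ! r}" "c < c'"
    then have "f (r, c) < f (r, c')"
      using f cell unfolding fillings_def by auto
    then show "f (r, c) \<noteq> f (r, c')" by simp
  qed
  moreover have "(\<lambda>c. f (r, c)) ` {lam ! r..<mu ! r} \<subseteq> {1..h * r}"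
  proof (intro image_subsetI)
    fix c assume "c \<in> {lam ! r..<mu ! r}"
    then have "(r, c) \<in> skew_diagram lam mu" using cell by auto
    moreover have "f \<in> (\<Pi>\<^sub>E (r, c) \<in> skew_diagram lam mu. {1..h * r})"
      using f by (simp add: fillings_def)
    ultimately show "f (r, c) \<in> {1..h * r}" by (auto dest: PiE_mem)
  qed
  ultimately have "card {lam ! r..<mu ! r} \<le> card {1..h * r}"
    by (intro card_inj_on_le) auto
  then show ?thesis by simp
qed

text \<open>An explicit filling works for every shape below the cap: entries are consecutive along a
  row, and down a column they grow because \<open>h * r\<close> increases strictly while the cap
  weakly decreases.\<close>

lemma fillings_nonempty:
  assumes h: "h \<ge> 1" and len: "length mu = length lam"
    and le: "\<And>r. r < length lam \<Longrightarrow> mu ! r \<le> cap h lam r"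
  shows "fillings h lam mu \<noteq> {}"
proof -
  \<comment> \<open>Normalized so that the last cell of a row of full length
    \<open>cap h lam r\<close> would receive the largest allowed entry \<open>h * r\<close>. The
    entry is at least 1 because \<open>c\<close> is at least \<open>lam ! r\<close> and the cap is
    at most \<open>lam ! r + h * r\<close>.\<close>
  define f where "f = (\<lambda>(r, c). if (r, c) \<in> skew_diagram lam mu
    then h * r + c + 1 - cap h lam r else undefined)"
  \<comment> \<open>Stated as an addition, so that comparing entries involves no truncated
    subtraction.\<close>
  have f: "f (r, c) + cap h lam r = h * r + c + 1" and b: "f (r, c) \<in> {1..h * r}"
    if "(r, c) \<in> skew_diagram lam mu" for r c
    using that le[of r] cap_le[of r r h lam] len by (auto simp: f_def diagram_def)
  have "f \<in> (\<Pi>\<^sub>E (r, c) \<in> skew_diagram lam mu. {1..h * r})"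
    using b by (auto simp: PiE_iff extensional_def f_def)
  moreover have "f (r, c) < f (r, c')"
    if "(r, c) \<in> skew_diagram lam mu" "(r, c') \<in> skew_diagram lam mu" "c < c'" for r c c'
    using f[OF that(1)] f[OF that(2)] that(3) by simp
  moreover have "f (r, c) < f (r', c)"
    if "(r, c) \<in> skew_diagram lam mu" "(r', c) \<in> skew_diagram lam mu" "r < r'" for r r' c
  proof -
    have "h * r < h * r'"
      using h that(3) by simp
    moreover have "cap h lam r' \<le> cap h lam r"
      using that(3) by (simp add: cap_antimono)
    ultimately show ?thesis
      using f[OF that(1)] f[OF that(2)] by linarith
  qed
  ultimately have "f \<in> fillings h lam mu"
    unfolding fillings_def by blast
  then show ?thesis by blast
qed

lemma diagram_subset_iff:
  "length mu = length lam \<Longrightarrow> diagram lam \<subseteq> diagram mu \<longleftrightarrow> (\<forall>r<length lam. lam ! r \<le> mu ! r)"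
  unfolding diagram_def subset_iff by (auto simp: not_le[symmetric])

text \<open>The bound on the growth of row \<open>i\<close> passes to every later row because
  \<open>mu\<close> is weakly decreasing; this turns the separate row bounds into the cap.\<close>

lemma A_set_iff:
  assumes h: "h \<ge> 1"
  shows "mu \<in> A_set h lam \<longleftrightarrow> is_partition mu \<and> length mu = length lam \<and>
    (\<forall>r<length lam. lam ! r \<le> mu ! r \<and> mu ! r \<le> cap h lam r)"
proof -
  have "(\<forall>r<length lam. mu ! r \<le> cap h lam r)"
    if "fillings h lam mu \<noteq> {}" "is_partition mu" "length mu = length lam"
  proof (intro allI impI)
    fix r assume r: "r < length lam"
    from that(1) obtain f where f: "f \<in> fillings h lam mu" by blast
    show "mu ! r \<le> cap h lam r"
      unfolding le_cap_iff
    proof (intro allI impI)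
      fix i assume "i \<le> r"
      then have "mu ! r \<le> mu ! i" "mu ! i \<le> lam ! i + h * i"
        using r that is_partition_nth[of mu i r] fillings_row_bound[OF f, of i] by auto
      then show "mu ! r \<le> lam ! i + h * i" by simp
    qed
  qed
  then show ?thesis
    using fillings_nonempty[OF h, of mu lam] diagram_subset_iff[of mu lam]
    by (auto simp: A_set_def b_coeff_def finite_fillings)
qed

subsection \<open>Contents of tableaux\<close>

definition content :: "nat list \<Rightarrow> (nat \<times> nat \<Rightarrow> 'n) \<Rightarrow> 'n \<Rightarrow>\<^sub>0 nat" where
  "content mu T = (\<Sum>p\<in>diagram mu. Poly_Mapping.single (T p) 1)"

lemma lookup_sum: "Poly_Mapping.lookup (\<Sum>x\<in>A. f x) a = (\<Sum>x\<in>A. Poly_Mapping.lookup (f x) a)"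
  by (induction A rule: infinite_finite_induct) (auto simp: lookup_add)

lemma sum_lookup_content:
  fixes S :: "'n::finite set"
  shows "(\<Sum>i\<in>S. Poly_Mapping.lookup (content mu T) i) = card {p \<in> diagram mu. T p \<in> S}"
proof -
  have "(\<Sum>i\<in>S. Poly_Mapping.lookup (content mu T) i) =
      (\<Sum>p\<in>diagram mu. \<Sum>i\<in>S. if i = T p then 1 else 0)"
    unfolding content_def lookup_sum lookup_single by (subst sum.swap) (auto simp: when_def eq_commute intro!: sum.cong)
  also have "\<dots> = (\<Sum>p\<in>diagram mu. if T p \<in> S then 1 else 0)"
    by (simp add: sum.delta')
  also have "\<dots> = card {p \<in> diagram mu. T p \<in> S}"
    by (simp add: sum.If_cases Int_def)
  finally show ?thesis .
qed

lemma lookup_content: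
  "Poly_Mapping.lookup (content mu T) (i :: 'n::finite) = card {p \<in> diagram mu. T p = i}"
  using sum_lookup_content[of mu T "{i}"] by simp

lemma schur_eq_sum_content:
  "(schur mu :: 'n::{finite,linorder} int_mpoly) = (\<Sum>T\<in>ssyt mu. Poly_Mapping.single (content mu T) 1)"
proof -
  have "(\<Prod>p\<in>A. mvar (T p)) = Poly_Mapping.single (\<Sum>p\<in>A. Poly_Mapping.single (T p) 1) 1"
    for A and T :: "nat \<times> nat \<Rightarrow> 'n"
    by (induction A rule: infinite_finite_induct)
      (simp_all add: mvar_def mult_single add.commute)
  then show ?thesis
    unfolding schur_def content_def by (simp only:)
qed

lemma lookup_schur:
  "Poly_Mapping.lookup (schur mu :: 'n::{finite,linorder} int_mpoly) a = int (card {T \<in> ssyt mu. content mu T = a})"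
  unfolding schur_eq_sum_content lookup_sum lookup_single
  by (simp add: finite_ssyt when_def sum.If_cases Int_def)

lemma lookup_scaled:
  fixes q :: "'n int_mpoly"
  shows "Poly_Mapping.lookup ((-1) ^ k * of_nat b * q) a = (-1) ^ k * int b * Poly_Mapping.lookup q a"
proof -
  have "Poly_Mapping.lookup (of_nat b * q) a = int b * Poly_Mapping.lookup q a"
    by (induction b) (auto simp: lookup_add algebra_simps)
  then show ?thesis
    by (cases "even k") (auto simp: lookup_uminus mult.assoc)
qed

lemma sum_lookup_eq_card_diagram:
  "content mu T = a \<Longrightarrow> (\<Sum>i\<in>UNIV. Poly_Mapping.lookup a (i::'n::finite)) = card (diagram mu)"
  using sum_lookup_content[of mu T UNIV] by auto

text \<open>There is no cancellation, because the sign of a term depends only on its degree.\<close>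

lemma keys_G_poly:
  "Poly_Mapping.keys (G_poly h lam :: 'n::{finite,linorder} int_mpoly) =
    {content mu T |mu T. mu \<in> A_set h lam \<and> T \<in> ssyt mu}"
proof (intro set_eqI)
  fix a :: "'n \<Rightarrow>\<^sub>0 nat"
  \<comment> \<open>The degree of the monomial \<open>a\<close> minus |lam|: the size of
    \<open>mu/lam\<close> for every \<open>mu\<close> that contributes to \<open>a\<close>, hence
    the common exponent of -1.\<close>
  define d where "d = (\<Sum>i\<in>UNIV. Poly_Mapping.lookup a i) - card (diagram lam)"
  define N where "N = (\<lambda>mu. card {T \<in> ssyt mu. content mu T = a})"
  have "Poly_Mapping.lookup (G_poly h lam) a =
      (\<Sum>mu\<in>A_set h lam. (-1) ^ card (skew_diagram lam mu) * int (b_coeff h lam mu) * int (N mu))"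
    unfolding G_poly_def lookup_sum lookup_scaled lookup_schur N_def ..
  also have "\<dots> = (\<Sum>mu\<in>A_set h lam. (-1) ^ d * int (b_coeff h lam mu * N mu))"
  proof (rule sum.cong[OF refl])
    fix mu assume mu: "mu \<in> A_set h lam"
    show "(-1) ^ card (skew_diagram lam mu) * int (b_coeff h lam mu) * int (N mu) =
      (-1) ^ d * int (b_coeff h lam mu * N mu)"
    proof (cases "N mu = 0")
      case False
      then obtain T where "T \<in> ssyt mu" "content mu T = a"
        by (auto simp: N_def card_eq_0_iff)
      then have "d = card (skew_diagram lam mu)"
        using mu by (simp add: d_def sum_lookup_eq_card_diagram A_set_def card_Diff_subset)
      then show ?thesis by simp
    qed simp
  qed
  also have "\<dots> = (-1) ^ d * int (\<Sum>mu\<in>A_set h lam. b_coeff h lam mu * N mu)"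
    by (simp add: sum_distrib_left)
  finally have "Poly_Mapping.lookup (G_poly h lam) a = \<dots>" .
  then have "a \<in> Poly_Mapping.keys (G_poly h lam) \<longleftrightarrow> (\<exists>mu\<in>A_set h lam. b_coeff h lam mu * N mu \<noteq> 0)"
    by (simp add: in_keys_iff finite_A_set flip: of_nat_sum of_nat_mult)
  also have "\<dots> \<longleftrightarrow> (\<exists>mu\<in>A_set h lam. N mu \<noteq> 0)"
    by (auto simp: A_set_def)
  also have "\<dots> \<longleftrightarrow> a \<in> {content mu T |mu T. mu \<in> A_set h lam \<and> T \<in> ssyt mu}"
    by (auto simp: N_def card_eq_0_iff finite_ssyt)
  finally show "a \<in> Poly_Mapping.keys (G_poly h lam) \<longleftrightarrow>
    a \<in> {content mu T |mu T. mu \<in> A_set h lam \<and> T \<in> ssyt mu}" .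
qed

section \<open>Column counts: bounding contents and realizing them by key tableaux\<close>

lemma card_diagram_Sigma: "card {p \<in> diagram mu. fst p < k} = (\<Sum>r<min k (length mu). mu ! r)"
proof -
  have "{p \<in> diagram mu. fst p < k} = (SIGMA r : {..<min k (length mu)}. {..<mu ! r})"
    by (auto simp: diagram_def)
  then show ?thesis by simp
qed

lemma card_diagram: "card (diagram mu) = (\<Sum>r<length mu. mu ! r)"
proof -
  have "diagram mu = {p \<in> diagram mu. fst p < length mu}"
    by (auto simp: diagram_def)
  then show ?thesis
    using card_diagram_Sigma[of mu "length mu"] by simp
qed

lemma card_by_columns:
  assumes "finite A"
  shows "card A = (\<Sum>c\<in>snd ` A. card {r. (r, c) \<in> A})"
proof -
  have "A = prod.swap ` (SIGMA c : snd ` A. {r. (r, c) \<in> A})"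
    by force
  then have "card A = card (SIGMA c : snd ` A. {r. (r, c) \<in> A})"
    by (metis card_image inj_swap)
  moreover have "finite {r. (r, c) \<in> A}" for c
    using finite_imageI[OF assms, of fst] by (rule rev_finite_subset) force
  ultimately show ?thesis
    using assms by simp
qed

text \<open>The entries of a column are distinct, so at most \<open>card S\<close> of them lie in \<open>S\<close>.\<close>

lemma sum_content_le:
  fixes T :: "nat \<times> nat \<Rightarrow> 'n::{finite,linorder}"
  assumes T: "T \<in> ssyt mu" and mu: "is_partition mu" and S: "card S \<le> length mu"
  shows "(\<Sum>i\<in>S. Poly_Mapping.lookup (content mu T) i) \<le> (\<Sum>r<card S. mu ! r)"
proof -
  let ?A = "{p \<in> diagram mu. T p \<in> S}" and ?B = "{p \<in> diagram mu. fst p < card S}"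
  let ?C = "snd ` diagram mu"
  have fin: "finite {r. (r, c) \<in> diagram mu \<and> P r}" for c P
    using finite_imageI[OF finite_diagram[of mu], of fst] by (rule rev_finite_subset) force
  have "card {r. (r, c) \<in> ?A} \<le> card {r. (r, c) \<in> ?B}" for c
  proof -
    have inj: "inj_on (\<lambda>r. T (r, c)) {r. (r, c) \<in> diagram mu}"
    proof (rule linorder_inj_onI')
      fix r r' assume "r \<in> {r. (r, c) \<in> diagram mu}" "r' \<in> {r. (r, c) \<in> diagram mu}" "r < r'"
      then have "T (r, c) < T (r', c)"
        using T unfolding ssyt_def by blast
      then show "T (r, c) \<noteq> T (r', c)" by simp
    qed
    have 1: "card {r. (r, c) \<in> ?A} \<le> card S"
      by (rule card_inj_on_le[of "\<lambda>r. T (r, c)"]) (auto intro: inj_on_subset[OF inj])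
    show ?thesis
    \<comment> \<open>A column with at least \<open>card S\<close> cells meets \<open>?B\<close> in
      exactly \<open>card S\<close> cells, which bounds the number of distinct entries in
      \<open>S\<close>; a shorter column lies entirely in \<open>?B\<close>.\<close>
    proof (cases "{..<card S} \<subseteq> {r. (r, c) \<in> diagram mu}")
      case True
      then have "{r. (r, c) \<in> ?B} = {..<card S}" by auto
      then show ?thesis using 1 by simp
    next
      case False
      then obtain q where q: "q < card S" "(q, c) \<notin> diagram mu" by auto
      have "r < q" if "(r, c) \<in> diagram mu" for r
        using that q is_partition_nth[OF mu, of q r] by (force simp: diagram_def)
      then have "{r. (r, c) \<in> ?A} \<subseteq> {r. (r, c) \<in> ?B}"
        using q by force
      then show ?thesis
        using fin by (intro card_mono) auto
    qed
  qed
  then have "(\<Sum>c\<in>?C. card {r. (r, c) \<in> ?A}) \<le> (\<Sum>c\<in>?C. card {r. (r, c) \<in> ?B})"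
    by (intro sum_mono)
  moreover have "card A = (\<Sum>c\<in>?C. card {r. (r, c) \<in> A})" if "A \<subseteq> diagram mu" for A
  proof -
    have "finite A" using that finite_diagram finite_subset by blast
    then show ?thesis
      unfolding card_by_columns[OF \<open>finite A\<close>]
      using that by (intro sum.mono_neutral_left) (force simp: card_eq_0_iff)+
  qed
  ultimately have "card ?A \<le> card ?B" by simp
  then show ?thesis
    using S by (simp add: sum_lookup_content card_diagram_Sigma min_absorb1)
qed

text \<open>Pigeonhole: otherwise the first \<open>k + 1\<close> elements of \<open>A\<close> would
  all be among the first \<open>k\<close> elements of \<open>B\<close>. This is what makes the rows
  of a key tableau weakly increasing, its columns being nested sets.\<close>

lemma sorted_list_of_set_nth_antimono:
  fixes A B :: "'n::{finite,linorder} set"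
  assumes "A \<subseteq> B" "k < card A"
  shows "sorted_list_of_set B ! k \<le> sorted_list_of_set A ! k"
proof (rule ccontr)
  let ?a = "sorted_list_of_set A" and ?b = "sorted_list_of_set B"
  assume "\<not> ?b ! k \<le> ?a ! k"
  then have less: "?a ! k < ?b ! k" by simp
  have kB: "k < card B"
    using assms card_mono[of B A] by simp
  have sa: "sorted_wrt (<) ?a" and sb: "sorted_wrt (<) ?b"
    by (rule strict_sorted_list_of_set)+
  have "(!) ?a ` {..k} \<subseteq> (!) ?b ` {..<k}"
  proof
    fix x assume "x \<in> (!) ?a ` {..k}"
    then obtain j where j: "x = ?a ! j" "j \<le> k" by auto
    have "x \<le> ?a ! k"
      using j assms(2) by (auto intro: sorted_nth_mono)
    have "x \<in> set ?b"
      using j assms by (metis finite le_less_trans length_sorted_list_of_set nth_mem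
          set_sorted_list_of_set subset_iff)
    then obtain i where i: "i < card B" "x = ?b ! i"
      by (metis in_set_conv_nth length_sorted_list_of_set)
    have "i < k"
    proof (rule ccontr)
      assume "\<not> i < k"
      then have "?b ! k \<le> ?b ! i" using i by (auto intro: sorted_nth_mono)
      then show False using i \<open>x \<le> ?a ! k\<close> less by auto
    qed
    then show "x \<in> (!) ?b ` {..<k}" using i by auto
  qed
  then have "card ((!) ?a ` {..k}) \<le> card ((!) ?b ` {..<k})"
    by (intro card_mono) auto
  also have "\<dots> \<le> k" using card_image_le[of "{..<k}" "(!) ?b"] by simp
  also have "card ((!) ?a ` {..k}) = Suc k"
    using assms by (subst card_image) (auto intro: inj_on_nth)
  finally show False by simp
qed

text \<open>The tableau is a key tableau: column \<open>c\<close> consists of all \<open>i\<close> with \<open>x i > c\<close>.\<close>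

lemma exists_ssyt_of_content:
  fixes x :: "'n::{finite,linorder} \<Rightarrow> nat"
  assumes mu: "is_partition mu" and e: "bij_betw e {..<length mu} (UNIV :: 'n set)"
    and x: "\<And>r. r < length mu \<Longrightarrow> x (e r) = mu ! r"
  shows "\<exists>T\<in>ssyt mu. \<forall>i. Poly_Mapping.lookup (content mu T) i = x i"
proof -
  define S where "S = (\<lambda>c. {i. c < x i})"
  define T where "T = (\<lambda>(r, c). if (r, c) \<in> diagram mu then sorted_list_of_set (S c) ! r else undefined)"
  have S_eq: "S c = e ` {r. (r, c) \<in> diagram mu}" for c
  proof -
    have "S c = e ` {r. r < length mu \<and> c < x (e r)}"
      using bij_betw_imp_surj_on[OF e] by (auto simp: S_def)
    also have "{r. r < length mu \<and> c < x (e r)} = {r. (r, c) \<in> diagram mu}"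
      using x by (auto simp: diagram_def)
    finally show ?thesis .
  qed
  have "inj_on e {r. (r, c) \<in> diagram mu}" for c
    by (rule inj_on_subset[OF bij_betw_imp_inj_on[OF e]]) (auto simp: diagram_def)
  then have card_S: "card (S c) = card {r. (r, c) \<in> diagram mu}" for c
    by (simp add: S_eq card_image)
  \<comment> \<open>Columns of a partition diagram are initial segments, so the height of column
    \<open>c\<close> is the size of \<open>S c\<close>.\<close>
  have col: "(r, c) \<in> diagram mu \<longleftrightarrow> r < card (S c)" for r c
  proof -
    have "\<exists>k. {r. (r, c) \<in> diagram mu} = {..<k}"
    proof -
      let ?D = "{r. (r, c) \<in> diagram mu}"
      have "finite ?D"
        using finite_imageI[OF finite_diagram[of mu], of fst] by (rule rev_finite_subset) force
      moreover have "r \<in> ?D" if "r' \<in> ?D" "r \<le> r'" for r r'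
        using that is_partition_nth[OF mu, of r r'] by (auto simp: diagram_def)
      ultimately have "?D = {..Max ?D}" if "?D \<noteq> {}"
        using that Max_in[of ?D] Max_ge[of ?D] by blast
      then show ?thesis
        by (cases "?D = {}") (metis lessThan_0, metis lessThan_Suc_atMost)
    qed
    then obtain k where k: "{r. (r, c) \<in> diagram mu} = {..<k}" by blast
    then have "card (S c) = k" by (simp only: card_S card_lessThan)
    then show ?thesis using k by blast
  qed
  have nth: "sorted_list_of_set (S c) ! r \<in> S c" if "r < card (S c)" for r c
    using that by (metis finite length_sorted_list_of_set nth_mem set_sorted_list_of_set)
  have "T \<in> ssyt mu"
  proof -
    have "T \<in> diagram mu \<rightarrow>\<^sub>E UNIV"
      by (auto simp: PiE_iff extensional_def T_def)
    moreover have "T (r, c) \<le> T (r, c')"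
      if "(r, c) \<in> diagram mu" "(r, c') \<in> diagram mu" "c < c'" for r c c'
    proof -
      have "S c' \<subseteq> S c" using that(3) by (auto simp: S_def)
      moreover have "r < card (S c')" using that(2) col by blast
      ultimately show ?thesis
        using sorted_list_of_set_nth_antimono that by (simp add: T_def)
    qed
    moreover have "T (r, c) < T (r', c)"
      if "(r, c) \<in> diagram mu" "(r', c) \<in> diagram mu" "r < r'" for r r' c
    proof -
      have "r' < card (S c)" using that(2) col by blast
      then show ?thesis
        using sorted_wrt_nth_less[OF strict_sorted_list_of_set, of r r' "S c"] that
        by (simp add: T_def)
    qed
    ultimately show ?thesis unfolding ssyt_def by blast
  qed
  moreover have "Poly_Mapping.lookup (content mu T) i = x i" for i
  proof -
    \<comment> \<open>The entry \<open>i\<close> occurs exactly once in each column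
      \<open>c < x i\<close> and in no other, so taking the column index is a bijection.\<close>
    have "card {p \<in> diagram mu. T p = i} = card {..<x i}"
    proof (rule bij_betw_same_card[of snd], rule bij_betw_imageI)
      show "inj_on snd {p \<in> diagram mu. T p = i}"
      proof (rule inj_onI)
        fix p q
        assume *: "p \<in> {p \<in> diagram mu. T p = i}" "q \<in> {p \<in> diagram mu. T p = i}" "snd p = snd q"
        obtain r r' c where pq: "p = (r, c)" "q = (r', c)"
          using *(3) by (metis prod.collapse)
        then have "r < card (S c)" "r' < card (S c)" using * col by blast+
        then show "p = q"
          using * pq nth_eq_iff_index_eq[of "sorted_list_of_set (S c)" r r'] by (auto simp: T_def)
      qed
      show "snd ` {p \<in> diagram mu. T p = i} = {..<x i}"
      proof (intro equalityI subsetI)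
        fix c assume "c \<in> snd ` {p \<in> diagram mu. T p = i}"
        then obtain r where "(r, c) \<in> diagram mu" "T (r, c) = i" by auto
        then show "c \<in> {..<x i}" using nth[of r c] col[of r c] by (simp add: T_def S_def)
      next
        fix c assume "c \<in> {..<x i}"
        then have "i \<in> set (sorted_list_of_set (S c))" by (simp add: S_def)
        then obtain r where "r < card (S c)" "sorted_list_of_set (S c) ! r = i"
          by (metis in_set_conv_nth length_sorted_list_of_set)
        then have "(r, c) \<in> {p \<in> diagram mu. T p = i}" using col[of r c] by (simp add: T_def)
        then show "c \<in> snd ` {p \<in> diagram mu. T p = i}" by force
      qed
    qed
    then show ?thesis by (simp add: lookup_content)
  qed
  ultimately show ?thesis by blast
qed

subsection \<open>Affine geometry\<close>

definition ind :: "'n::finite set \<Rightarrow> real ^ 'n" where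
  "ind S = (\<chi> i. if i \<in> S then 1 else 0)"

lemma inner_ind: "ind S \<bullet> x = (\<Sum>i\<in>S. x $ i)"
  by (simp add: ind_def inner_vec_def sum.If_cases if_distrib[of "\<lambda>a. a * _"] cong: if_cong)

lemma ind_nonzero: "S \<noteq> {} \<Longrightarrow> ind S \<noteq> 0"
  by (auto simp: ind_def vec_eq_iff)

text \<open>A difference of two points of an affine set is a direction of it, up to any scalar, so
  the multiples of the \<open>d j\<close> can be added one after another.\<close>

lemma affine_add_directions:
  fixes d :: "'n \<Rightarrow> 'v::real_vector"
  assumes "affine A" "a \<in> A" "finite J"
    and d: "\<And>j. j \<in> J \<Longrightarrow> \<exists>u\<in>A. \<exists>v\<in>A. \<exists>t. t \<noteq> 0 \<and> u - v = t *\<^sub>R d j"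
  shows "a + (\<Sum>j\<in>J. c j *\<^sub>R d j) \<in> A"
  using \<open>finite J\<close> d
proof (induction J)
  case (insert j J)
  then obtain u v t where uv: "u \<in> A" "v \<in> A" "t \<noteq> 0" "u - v = t *\<^sub>R d j"
    by (meson insertI1)
  have "a + (\<Sum>j\<in>J. c j *\<^sub>R d j) \<in> A"
    using insert by auto
  then have "a + (\<Sum>j\<in>J. c j *\<^sub>R d j) + (c j / t) *\<^sub>R (u - v) \<in> A"
    using mem_affine_3_minus[OF \<open>affine A\<close>] uv by blast
  then show ?case
    using insert.hyps uv by (simp add: algebra_simps)
qed (use \<open>a \<in> A\<close> in simp)

lemma vec_eq_sum_axis: "x = (\<Sum>j\<in>UNIV. x $ j *\<^sub>R axis j 1)" for x :: "real ^ 'n"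
  by (simp add: vec_eq_iff axis_def if_distrib cong: if_cong)

text \<open>The vectors \<open>axis i 1 - axis j 1\<close> with both indices in \<open>S\<close> and
  \<open>axis j 1\<close> with \<open>j\<close> outside \<open>S\<close> span the direction space of
  the hyperplane; \<open>swap\<close> and \<open>free\<close> provide them as differences of points
  of \<open>F\<close>.\<close>

lemma affine_hull_eq_hyperplane:
  fixes F :: "(real ^ 'n) set"
  assumes F: "F \<subseteq> {x. ind S \<bullet> x = \<beta>}" "F \<noteq> {}" and S: "S \<noteq> {}"
    and swap: "\<And>i j. i \<in> S \<Longrightarrow> j \<in> S \<Longrightarrow> i \<noteq> j \<Longrightarrow>
      \<exists>u\<in>F. \<exists>v\<in>F. \<exists>t. t \<noteq> 0 \<and> u - v = t *\<^sub>R (axis i 1 - axis j 1)"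
    and free: "\<And>j. j \<notin> S \<Longrightarrow> \<exists>u\<in>F. \<exists>v\<in>F. \<exists>t. t \<noteq> 0 \<and> u - v = t *\<^sub>R axis j 1"
  shows "affine hull F = {x. ind S \<bullet> x = \<beta>}"
proof
  show "affine hull F \<subseteq> {x. ind S \<bullet> x = \<beta>}"
    using F by (intro hull_minimal affine_hyperplane)
  show "{x. ind S \<bullet> x = \<beta>} \<subseteq> affine hull F"
  proof
    fix x assume x: "x \<in> {x. ind S \<bullet> x = \<beta>}"
    obtain a where a: "a \<in> F" using F by blast
    obtain k where k: "k \<in> S" using S by blast
    \<comment> \<open>The coordinates of \<open>x - a\<close> over \<open>S\<close> sum to zero, so
      in the combination with these coefficients the multiples of \<open>axis k 1\<close> cancel.
      The vector \<open>d k\<close> is zero.\<close>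
    define d :: "'n \<Rightarrow> real ^ 'n" where "d = (\<lambda>j. axis j 1 - (if j \<in> S then axis k 1 else 0))"
    have sub: "F \<subseteq> affine hull F" by (rule hull_subset)
    have "a + (\<Sum>j\<in>UNIV. (x - a) $ j *\<^sub>R d j) \<in> affine hull F"
    proof (rule affine_add_directions)
      show "\<exists>u\<in>affine hull F. \<exists>v\<in>affine hull F. \<exists>t. t \<noteq> 0 \<and> u - v = t *\<^sub>R d j" for j
      proof (cases "j \<in> S \<and> j \<noteq> k")
        case True
        then show ?thesis using swap[of j k] k sub by (auto simp: d_def)
      next
        case False
        show ?thesis
        proof (cases "j = k")
          case True
          then have "d j = 0" using k by (simp add: d_def)
          then show ?thesis using a sub
            by (intro bexI[of _ a] exI[of _ 1]) auto
        next
          case 2: False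
          then show ?thesis using False free[of j] sub by (auto simp: d_def)
        qed
      qed
    qed (use a sub in auto)
    moreover have "(\<Sum>j\<in>UNIV. (x - a) $ j *\<^sub>R d j) = x - a"
    proof -
      have "(\<Sum>j\<in>UNIV. (x - a) $ j *\<^sub>R d j) =
          (\<Sum>j\<in>UNIV. (x - a) $ j *\<^sub>R axis j 1) - (\<Sum>j\<in>UNIV. if j \<in> S then (x - a) $ j *\<^sub>R axis k 1 else 0)"
        unfolding d_def sum_subtractf[symmetric] by (intro sum.cong) (auto simp: algebra_simps)
      also have "(\<Sum>j\<in>UNIV. if j \<in> S then (x - a) $ j *\<^sub>R axis k 1 else 0) =
          (\<Sum>j\<in>S. (x - a) $ j) *\<^sub>R axis k (1::real)"
        by (simp add: sum.If_cases scaleR_left.sum)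
      also have "(\<Sum>j\<in>S. (x - a) $ j) = 0"
        using x a F by (auto simp: sum_subtractf inner_ind subset_iff)
      also have "(\<Sum>j\<in>UNIV. (x - a) $ j *\<^sub>R axis j 1) = x - a"
        by (rule vec_eq_sum_axis[symmetric])
      finally show ?thesis by simp
    qed
    ultimately show "x \<in> affine hull F" by simp
  qed
qed

text \<open>The functional \<open>ind S\<close> is integral on lattice points, but strictly between
  the two hyperplanes it differs from the integer \<beta> by some t or -t with 0 < t < 1.\<close>

lemma no_lattice_points_between:
  assumes F: "affine hull F \<subseteq> {x. ind S \<bullet> x = real \<beta>}"
    and p: "\<bar>ind S \<bullet> p - real \<beta>\<bar> = 1"
  shows "lattice_points \<inter> strictly_between p F = {}"
proof (intro equals0I)
  fix x assume "x \<in> lattice_points \<inter> strictly_between p F"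
  then obtain a b where ab: "a \<in> affine hull F" "b \<in> parallel_through p F" "x \<in> open_segment a b"
    and x: "x \<in> lattice_points"
    by (auto simp: strictly_between_def)
  obtain a' q where b: "b = a' + (p - q)" "a' \<in> affine hull F" "q \<in> affine hull F"
    using ab by (auto simp: parallel_through_def)
  obtain t where t: "0 < t" "t < 1" "x = (1 - t) *\<^sub>R a + t *\<^sub>R b"
    using ab by (auto simp: in_segment)
  have a: "ind S \<bullet> a = \<beta>" and "ind S \<bullet> b = ind S \<bullet> p"
    using ab b F by (auto simp: inner_simps subset_iff)
  then have *: "ind S \<bullet> x = \<beta> + t * (ind S \<bullet> p - \<beta>)"
    by (simp add: t inner_simps algebra_simps)
  have "ind S \<bullet> x \<in> \<int>"
    using x by (auto simp: inner_ind lattice_points_def)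
  then obtain k where "ind S \<bullet> x = of_int k" by (auto elim: Ints_cases)
  then have "of_int (k - int \<beta>) = t * (ind S \<bullet> p - \<beta>)" using * by simp
  moreover have "ind S \<bullet> p - \<beta> = 1 \<or> ind S \<bullet> p - \<beta> = -1" using p by linarith
  ultimately have "of_int (k - int \<beta>) = t \<or> of_int (k - int \<beta>) = -t" by auto
  then have "0 < \<bar>k - int \<beta>\<bar> \<and> \<bar>k - int \<beta>\<bar> < 1" using t by linarith
  then show False by simp
qed

text \<open>If the distance exceeded one, a unit step from \<open>p\<close> along a coordinate in
  \<open>S\<close> towards the hyperplane would end at a lattice point strictly between; such a step
  changes \<open>ind S\<close> by exactly one.\<close>

lemma lattice_distance_le_1:
  assumes F: "affine hull F = {x. ind S \<bullet> x = real \<beta>}" and S: "S \<noteq> {}"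
    and p: "p \<in> lattice_points"
    and none: "lattice_points \<inter> strictly_between p F = {}"
  shows "\<bar>ind S \<bullet> p - real \<beta>\<bar> \<le> 1"
proof (rule ccontr)
  define \<delta> where "\<delta> = \<beta> - ind S \<bullet> p"
  assume "\<not> \<bar>ind S \<bullet> p - real \<beta>\<bar> \<le> 1"
  then have \<delta>: "1 < \<bar>\<delta>\<bar>" by (simp add: \<delta>_def)
  obtain k where k: "k \<in> S" using S by blast
  have ind_axis: "ind S \<bullet> (axis k c :: real ^ _) = c" for c
    using k by (simp add: inner_ind axis_def)
  \<comment> \<open>\<open>a\<close> is where the line through \<open>p\<close> in direction
    \<open>axis k 1\<close> meets the hyperplane, and \<open>x\<close> lies one unit from
    \<open>p\<close> on the way to it.\<close>
  define a where "a = p + axis k \<delta>"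
  define x where "x = p + axis k (sgn \<delta>)"
  have a: "a \<in> affine hull F"
    unfolding F a_def by (simp add: inner_simps ind_axis \<delta>_def)
  have "a + (p - a) \<in> parallel_through p F"
    using a unfolding parallel_through_def by blast
  then have "p \<in> parallel_through p F" by simp
  moreover have "x \<in> open_segment a p"
    unfolding in_segment
  proof (intro conjI exI[of _ "1 - 1 / \<bar>\<delta>\<bar>"])
    show "a \<noteq> p"
      using \<delta> ind_axis[of \<delta>] by (auto simp: a_def)
    have "sgn \<delta> = (1 / \<bar>\<delta>\<bar>) * \<delta>" using \<delta> by (auto simp: sgn_if)
    then have "axis k (sgn \<delta>) = (1 / \<bar>\<delta>\<bar>) *\<^sub>R (axis k \<delta> :: real ^ 'a)"
      by (auto simp: vec_eq_iff axis_def)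
    then show "x = (1 - (1 - 1 / \<bar>\<delta>\<bar>)) *\<^sub>R a + (1 - 1 / \<bar>\<delta>\<bar>) *\<^sub>R p"
      by (simp add: x_def a_def algebra_simps)
  qed (use \<delta> in auto)
  ultimately have "x \<in> strictly_between p F"
    using a by (auto simp: strictly_between_def)
  moreover have "x \<in> lattice_points"
    using p by (auto simp: x_def lattice_points_def axis_def sgn_if)
  ultimately show False using none by blast
qed

subsection \<open>Bijections and weighted sums\<close>

text \<open>Assigns rows to coordinates so that the rows \<open>T\<close> fill \<open>S\<close> and
  two chosen rows land on two chosen coordinates. Exchanging these rows then gives a difference
  along \<open>axis i 1 - axis j 1\<close>.\<close>

lemma obtain_bij_pair:
  fixes S :: "'n::finite set"
  assumes T: "T \<subseteq> {..<CARD('n)}" "card T = card S" and S: "i \<in> S" "j \<in> S" "i \<noteq> j"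
    and ab: "a \<in> T" "b \<in> T" "a \<noteq> b"
  obtains e where "bij_betw e {..<CARD('n)} UNIV" "e ` T = S" "e a = i" "e b = j"
proof -
  have [simp]: "finite T" using T finite_subset by auto
  have "card (T - {a, b}) = card (S - {i, j})"
    using T S ab by (simp add: card_Diff_subset)
  then obtain f where f: "bij_betw f (T - {a, b}) (S - {i, j})"
    using finite_same_card_bij[of "T - {a, b}" "S - {i, j}"] by auto
  have "card ({..<CARD('n)} - T) = card (- S)"
    using T by (simp add: card_Diff_subset Compl_eq_Diff_UNIV)
  then obtain g where g: "bij_betw g ({..<CARD('n)} - T) (- S)"
    using finite_same_card_bij[of "{..<CARD('n)} - T" "- S"] by auto
  define e where "e = (\<lambda>r. if r = a then i else if r = b then j else if r \<in> T then f r else g r)"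
  have "bij_betw e {a, b} {i, j}"
    using S ab by (auto simp: bij_betw_def e_def)
  moreover have "bij_betw e (T - {a, b}) (S - {i, j})"
    using f by (rule bij_betw_cong[THEN iffD1, rotated]) (auto simp: e_def)
  ultimately have "bij_betw e ({a, b} \<union> (T - {a, b})) ({i, j} \<union> (S - {i, j}))"
    by (rule bij_betw_combine) auto
  then have 1: "bij_betw e T S"
    using S ab by (simp add: insert_absorb)
  moreover have "bij_betw e ({..<CARD('n)} - T) (- S)"
    using g by (rule bij_betw_cong[THEN iffD1, rotated]) (use ab in \<open>auto simp: e_def\<close>)
  ultimately have "bij_betw e (T \<union> ({..<CARD('n)} - T)) (S \<union> - S)"
    by (rule bij_betw_combine) auto
  moreover have "T \<union> ({..<CARD('n)} - T) = {..<CARD('n)}" using T by auto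
  ultimately have "bij_betw e {..<CARD('n)} UNIV" by simp
  moreover have "e a = i" "e b = j" using ab by (auto simp: e_def)
  ultimately show ?thesis
    using that bij_betw_imp_surj_on[OF 1] by blast
qed

text \<open>The companion for a coordinate outside \<open>S\<close>: a chosen row outside
  \<open>T\<close> lands on \<open>j\<close>, so varying that row moves along
  \<open>axis j 1\<close>.\<close>

lemma obtain_bij_outside:
  fixes S :: "'n::finite set"
  assumes T: "T \<subseteq> {..<CARD('n)}" "card T = card S" and j: "j \<notin> S" and b: "b \<notin> T" "b < CARD('n)"
  obtains e where "bij_betw e {..<CARD('n)} UNIV" "e ` T = S" "e b = j"
proof -
  have [simp]: "finite T" using T finite_subset by auto
  obtain f where f: "bij_betw f T S"
    using finite_same_card_bij[of T S] T by auto
  have "card ({..<CARD('n)} - T - {b}) = card (- S - {j})"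
    using T j b by (simp add: card_Diff_subset Compl_eq_Diff_UNIV)
  then obtain g where g: "bij_betw g ({..<CARD('n)} - T - {b}) (- S - {j})"
    using finite_same_card_bij[of "{..<CARD('n)} - T - {b}" "- S - {j}"] by auto
  define e where "e = (\<lambda>r. if r = b then j else if r \<in> T then f r else g r)"
  have 1: "bij_betw e T S"
    using f by (rule bij_betw_cong[THEN iffD1, rotated]) (use b in \<open>auto simp: e_def\<close>)
  moreover have "bij_betw e {b} {j}"
    by (auto simp: bij_betw_def e_def)
  ultimately have "bij_betw e (T \<union> {b}) (S \<union> {j})"
    by (rule bij_betw_combine) (use j in auto)
  moreover have "bij_betw e ({..<CARD('n)} - T - {b}) (- S - {j})"
    using g by (rule bij_betw_cong[THEN iffD1, rotated]) (auto simp: e_def)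
  ultimately have "bij_betw e ((T \<union> {b}) \<union> ({..<CARD('n)} - T - {b})) ((S \<union> {j}) \<union> (- S - {j}))"
    by (rule bij_betw_combine) auto
  moreover have "(T \<union> {b}) \<union> ({..<CARD('n)} - T - {b}) = {..<CARD('n)}" using T b by auto
  moreover have "(S \<union> {j}) \<union> (- S - {j}) = UNIV" by auto
  ultimately have "bij_betw e {..<CARD('n)} UNIV" by metis
  moreover have "e b = j" by (simp add: e_def)
  ultimately show ?thesis
    using that bij_betw_imp_surj_on[OF 1] by blast
qed

lemma obtain_bij:
  fixes S :: "'n::finite set"
  assumes T: "T \<subseteq> {..<CARD('n)}" "card T = card S"
  obtains e where "bij_betw e {..<CARD('n)} UNIV" "e ` T = S"
proof (cases "S = UNIV")
  case True
  then have "T = {..<CARD('n)}"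
    using T by (intro card_subset_eq) auto
  then show ?thesis
    using finite_same_card_bij[of "{..<CARD('n)}" "UNIV :: 'n set"] that True
    by (auto simp: bij_betw_def)
next
  case False
  then obtain j where j: "j \<notin> S" by blast
  have "T \<noteq> {..<CARD('n)}"
  proof
    assume "T = {..<CARD('n)}"
    then have "card S = CARD('n)" using T by simp
    then show False using False card_subset_eq[of UNIV S] by auto
  qed
  then obtain b where "b \<notin> T" "b < CARD('n)" using T by auto
  then show ?thesis using obtain_bij_outside[OF T j] that by metis
qed

lemma obtain_sorting_bij:
  fixes w :: "'n::finite \<Rightarrow> real"
  obtains e where "bij_betw e {..<CARD('n)} UNIV"
    "\<And>i j. i \<le> j \<Longrightarrow> j < CARD('n) \<Longrightarrow> w (e j) \<le> w (e i)"
proof -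
  obtain xs where xs: "set xs = (UNIV :: 'n set)" "distinct xs"
    using finite_distinct_list[of "UNIV :: 'n set"] by auto
  define ys where "ys = sort_key (\<lambda>i. - w i) xs"
  have ys: "set ys = UNIV" "distinct ys" using xs by (auto simp: ys_def)
  then have len: "length ys = CARD('n)" using distinct_card by fastforce
  have "sorted (map (\<lambda>i. - w i) ys)" by (simp add: ys_def)
  then have "w (ys ! j) \<le> w (ys ! i)" if "i \<le> j" "j < CARD('n)" for i j
    using that len sorted_nth_mono[of "map (\<lambda>i. - w i) ys" i j] by simp
  moreover have "bij_betw ((!) ys) {..<CARD('n)} UNIV"
    using bij_betw_nth[of ys "{..<CARD('n)}" UNIV] ys len by auto
  ultimately show ?thesis using that by blast
qed

text \<open>Summation by parts as an induction: the sum of \<open>w i * d i\<close> up to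
  \<open>k\<close> is at least \<open>w k\<close> times the partial sum of \<open>d\<close>, which
  persists because the partial sum is nonnegative and the weight only drops.\<close>

lemma sum_antimono_weights_nonneg:
  fixes w d :: "nat \<Rightarrow> real"
  assumes w: "\<And>i j. i \<le> j \<Longrightarrow> j < n \<Longrightarrow> w j \<le> w i" "\<And>i. i < n \<Longrightarrow> 0 \<le> w i"
    and d: "\<And>k. k \<le> n \<Longrightarrow> 0 \<le> (\<Sum>i<k. d i)"
  shows "0 \<le> (\<Sum>i<n. w i * d i)"
proof (cases n)
  case (Suc n')
  have "w k * (\<Sum>i<Suc k. d i) \<le> (\<Sum>i<Suc k. w i * d i)" if "k < n" for k
    using that
  proof (induction k)
    case (Suc k)
    have "w (Suc k) * (\<Sum>i<Suc (Suc k). d i) = w (Suc k) * (\<Sum>i<Suc k. d i) + w (Suc k) * d (Suc k)"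
      by (simp add: algebra_simps)
    also have "w (Suc k) * (\<Sum>i<Suc k. d i) \<le> w k * (\<Sum>i<Suc k. d i)"
      using Suc.prems by (intro mult_right_mono w d) auto
    also have "\<dots> \<le> (\<Sum>i<Suc k. w i * d i)"
      using Suc by simp
    finally show ?case by simp
  qed simp
  from this[of n'] have "w n' * (\<Sum>i<n. d i) \<le> (\<Sum>i<n. w i * d i)"
    using Suc by simp
  moreover have "0 \<le> w n' * (\<Sum>i<n. d i)"
    using Suc by (intro mult_nonneg_nonneg w d) auto
  ultimately show ?thesis by linarith
qed simp

subsection \<open>The Newton polytope by vertices and by inequalities\<close>

text \<open>The argument \<open>ty\<close> only carries the index type of the variables, so that
  \<open>CARD('n)\<close> plays the role of m throughout.\<close>

locale partition_data =
  fixes h :: nat and lam :: "nat list" and ty :: "'n::{finite,linorder} itself"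
  assumes h: "h \<ge> 1" and lam: "is_partition lam" and len: "length lam = CARD('n)"
    and last: "last lam = 0" and nonzero: "lam \<noteq> replicate CARD('n) 0" and m: "CARD('n) \<ge> 2"
begin

abbreviation "M \<equiv> cap h lam"

abbreviation P :: "(real, 'n) vec set" where
  "P \<equiv> Newt (G_poly h lam)"

definition upper :: "nat \<Rightarrow> nat" where
  "upper k = (\<Sum>r<k. M r)"

definition lower :: "nat \<Rightarrow> nat" where
  "lower k = (\<Sum>r=CARD('n) - k..<CARD('n). lam ! r)"

lemma lam_antimono: "i \<le> j \<Longrightarrow> j < CARD('n) \<Longrightarrow> lam ! j \<le> lam ! i"
  using is_partition_nth[OF lam] len by simp

lemma lam_le_M: "r < CARD('n) \<Longrightarrow> lam ! r \<le> M r"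
  using le_cap[OF lam] len by simp

lemma lam_last: "lam ! (CARD('n) - 1) = 0"
  using last len m by (subst (asm) last_conv_nth) auto

lemma lam_0_pos: "0 < lam ! 0"
proof (rule ccontr)
  assume "\<not> 0 < lam ! 0"
  then have "lam ! r = 0" if "r < CARD('n)" for r
    using lam_antimono[of 0 r] that by simp
  then have "lam = replicate CARD('n) 0"
    using len by (intro nth_equalityI) auto
  then show False using nonzero by simp
qed

text \<open>The source of full dimension: the last part of \<open>lam\<close> is 0 while its cap is
  positive, so the last row can always vary.\<close>

lemma M_pos: "0 < M r"
proof -
  have "1 \<le> M r"
    unfolding le_cap_iff
  proof (intro allI impI)
    fix i
    show "1 \<le> lam ! i + h * i"
      using lam_0_pos h by (cases i) auto
  qed
  then show ?thesis by simp
qed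

text \<open>The maximizer for weights in decreasing order of which exactly the first
  \<open>k\<close> are positive: rows with positive weight are as long as possible, the others as
  short as possible.\<close>

definition corner :: "nat \<Rightarrow> nat \<Rightarrow> nat" where
  "corner k r = (if r < k then M r else lam ! r)"

definition place :: "(nat \<Rightarrow> 'n) \<Rightarrow> (nat \<Rightarrow> nat) \<Rightarrow> (real, 'n) vec" where
  "place e v = (\<chi> i. real (v (inv_into {..<CARD('n)} e i)))"

lemma place_nth: "bij_betw e {..<CARD('n)} UNIV \<Longrightarrow> r < CARD('n) \<Longrightarrow> place e v $ e r = real (v r)"
  by (simp add: place_def bij_betw_def inv_into_f_f)

lemma inner_ind_place:
  assumes "bij_betw e {..<CARD('n)} UNIV" "e ` T = S" "T \<subseteq> {..<CARD('n)}"
  shows "ind S \<bullet> place e v = real (\<Sum>r\<in>T. v r)"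
proof -
  have "inj_on e T"
    using assms bij_betw_imp_inj_on inj_on_subset by blast
  then have "ind S \<bullet> place e v = (\<Sum>r\<in>T. place e v $ e r)"
    using assms by (simp add: inner_ind sum.reindex flip: assms(2))
  also have "\<dots> = (\<Sum>r\<in>T. real (v r))"
    using assms by (intro sum.cong) (auto simp: place_nth)
  finally show ?thesis by simp
qed

text \<open>\<open>corner k\<close> is itself a partition between \<open>lam\<close> and the caps,
  and every permutation of it is the content of a key tableau of that shape.\<close>

lemma place_corner_in_P:
  assumes e: "bij_betw e {..<CARD('n)} UNIV"
  shows "place e (corner k) \<in> P"
proof -
  define mu where "mu = map (corner k) [0..<CARD('n)]"
  have len_mu: "length mu = CARD('n)" and nth_mu: "\<And>r. r < CARD('n) \<Longrightarrow> mu ! r = corner k r"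
    by (auto simp: mu_def)
  have part: "is_partition mu"
  proof (rule is_partitionI)
    fix i j assume "i < j" "j < length mu"
    then have "corner k j \<le> corner k i"
      using cap_antimono[of i j h lam] lam_antimono[of i j] lam_le_M[of i] len_mu
      by (auto simp: corner_def)
    then show "mu ! j \<le> mu ! i"
      using \<open>i < j\<close> \<open>j < length mu\<close> len_mu nth_mu by simp
  qed
  have A: "mu \<in> A_set h lam"
    using part len_mu nth_mu len lam_le_M by (auto simp: A_set_iff[OF h] corner_def)
  define x where "x = (\<lambda>i. corner k (inv_into {..<CARD('n)} e i))"
  have "x (e r) = mu ! r" if "r < length mu" for r
    using that e nth_mu len_mu by (simp add: x_def bij_betw_def inv_into_f_f)
  then obtain T where T: "T \<in> ssyt mu" "\<And>i. Poly_Mapping.lookup (content mu T) i = x i"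
    using exists_ssyt_of_content[OF part, of e x] e len_mu by auto
  then have "content mu T \<in> Poly_Mapping.keys (G_poly h lam)"
    using A by (auto simp: keys_G_poly)
  moreover have "place e (corner k) = exponent_vector (content mu T)"
    by (simp add: exponent_vector_def place_def T x_def)
  ultimately show ?thesis
    unfolding Newt_def by (auto intro: hull_inc)
qed

lemma lattice_polytope_P: "lattice_polytope P"
  unfolding lattice_polytope_def Newt_def
  by (rule exI[of _ "exponent_vector ` Poly_Mapping.keys (G_poly h lam)"])
    (auto simp: lattice_points_def exponent_vector_def)

lemma sum_complement:
  fixes x :: "(real, 'n) vec"
  shows "(\<Sum>i\<in>UNIV. x $ i) = ind S \<bullet> x + ind (- S) \<bullet> x"
  unfolding inner_ind using sum.union_disjoint[of S "- S" "\<lambda>i. x $ i"] by simp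

lemma sum_lam_split: "k \<le> CARD('n) \<Longrightarrow> lower CARD('n) = (\<Sum>r<CARD('n) - k. lam ! r) + lower k"
  unfolding lower_def lessThan_atLeast0 by (simp add: sum.atLeastLessThan_concat)

lemma card_le_m: "card (S :: 'n set) \<le> CARD('n)"
  by (rule card_mono) auto

text \<open>The upper bound is the column count. The lower bound is the same count for the
  complement: |mu| minus the first rows of \<open>mu\<close> leaves the last \<open>card S\<close>
  rows, each at least the corresponding part of \<open>lam\<close>.\<close>

lemma ind_bounds:
  assumes "x \<in> P"
  shows "lower (card S) \<le> ind S \<bullet> x" "ind S \<bullet> x \<le> upper (card S)"
proof -
  let ?E = "exponent_vector ` Poly_Mapping.keys (G_poly h lam :: 'n int_mpoly)"
  have *: "real (lower (card S)) \<le> ind S \<bullet> y \<and> ind S \<bullet> y \<le> upper (card S)" if y: "y \<in> ?E" for y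
  proof -
    obtain mu T where mu: "mu \<in> A_set h lam" and T: "T \<in> ssyt mu"
      and y_eq: "y = exponent_vector (content mu T)"
      using y by (auto simp: keys_G_poly)
    have part: "is_partition mu" and len_mu: "length mu = CARD('n)"
      and le: "\<And>r. r < CARD('n) \<Longrightarrow> lam ! r \<le> mu ! r \<and> mu ! r \<le> M r"
      using mu len by (auto simp: A_set_iff[OF h])
    have ind_y: "ind R \<bullet> y = real (\<Sum>i\<in>R. Poly_Mapping.lookup (content mu T) i)" for R
      by (simp add: inner_ind y_eq exponent_vector_def)
    have bound: "(\<Sum>i\<in>R. Poly_Mapping.lookup (content mu T) i) \<le> (\<Sum>r<card R. mu ! r)" for R
      using card_le_m[of R] len_mu by (intro sum_content_le[OF T part]) simp
    have "(\<Sum>r<card S. mu ! r) \<le> upper (card S)"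
      unfolding upper_def using le card_le_m[of S] by (intro sum_mono) auto
    with bound[of S] have "ind S \<bullet> y \<le> upper (card S)"
      unfolding ind_y by linarith
    moreover have "lower (card S) \<le> ind S \<bullet> y"
    proof -
      have "(\<Sum>i\<in>UNIV. Poly_Mapping.lookup (content mu T) i) = (\<Sum>r<CARD('n). mu ! r)"
        by (simp add: sum_lookup_eq_card_diagram card_diagram len_mu)
      also have "\<dots> = (\<Sum>r<CARD('n) - card S. mu ! r) + (\<Sum>r=CARD('n) - card S..<CARD('n). mu ! r)"
        unfolding lessThan_atLeast0 by (simp add: sum.atLeastLessThan_concat)
      also have "(\<Sum>r<CARD('n) - card S. mu ! r) = (\<Sum>r<card (- S). mu ! r)"
        by (simp add: Compl_eq_Diff_UNIV card_Diff_subset)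
      finally have "lower (card S) + (\<Sum>i\<in>- S. Poly_Mapping.lookup (content mu T) i) \<le>
          (\<Sum>i\<in>UNIV. Poly_Mapping.lookup (content mu T) i)"
        using bound[of "- S"] sum_mono[of "{CARD('n) - card S..<CARD('n)}" "(!) lam" "(!) mu"] le
        by (simp add: lower_def)
      also have "\<dots> = (\<Sum>i\<in>S. Poly_Mapping.lookup (content mu T) i) + (\<Sum>i\<in>- S. Poly_Mapping.lookup (content mu T) i)"
        using sum.union_disjoint[of S "- S" "Poly_Mapping.lookup (content mu T)"] by simp
      finally show ?thesis unfolding ind_y of_nat_le_iff by simp
    qed
    ultimately show ?thesis by blast
  qed
  have "convex hull ?E \<subseteq> {y. ind S \<bullet> y \<ge> lower (card S)} \<inter> {y. ind S \<bullet> y \<le> upper (card S)}"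
    using * by (intro hull_minimal convex_Int convex_halfspace_le convex_halfspace_ge) auto
  then show "lower (card S) \<le> ind S \<bullet> x" "ind S \<bullet> x \<le> upper (card S)"
    using assms unfolding Newt_def by auto
qed

text \<open>If a hyperplane separated \<open>x\<close> from the polytope, the corner that is optimal
  for its normal vector would still do no better than \<open>x\<close>, by summation by parts
  applied to the slacks of the inequalities.\<close>

lemma in_P_of_bounds:
  fixes x :: "(real, 'n) vec"
  assumes x: "\<And>S. lower (card S) \<le> ind S \<bullet> x" "\<And>S. ind S \<bullet> x \<le> upper (card S)"
  shows "x \<in> P"
proof (rule ccontr)
  assume "x \<notin> P"
  moreover have "convex P" "closed P"
    unfolding Newt_def by (auto intro!: compact_imp_closed finite_imp_compact_convex_hull)
  ultimately obtain a b where ab: "a \<bullet> x < b" "\<And>y. y \<in> P \<Longrightarrow> b < a \<bullet> y"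
    using separating_hyperplane_closed_point by metis
  define w where "w = (\<lambda>i. - a $ i)"
  obtain e where e: "bij_betw e {..<CARD('n)} (UNIV :: 'n set)"
    and w: "\<And>i j. i \<le> j \<Longrightarrow> j < CARD('n) \<Longrightarrow> w (e j) \<le> w (e i)"
    using obtain_sorting_bij[of w] by blast
  define k where "k = card {r. r < CARD('n) \<and> 0 < w (e r)}"
  have k: "0 < w (e r) \<longleftrightarrow> r < k" if "r < CARD('n)" for r
  proof -
    let ?D = "{r. r < CARD('n) \<and> 0 < w (e r)}"
    have "finite ?D" by simp
    have down: "r \<in> ?D" if "r' \<in> ?D" "r \<le> r'" for r r'
      using that w[of r r'] by auto
    show ?thesis
    proof
      assume "0 < w (e r)"
      then have "{..r} \<subseteq> ?D" using down that by auto
      then have "card {..r} \<le> k" unfolding k_def using card_mono \<open>finite ?D\<close> by blast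
      then show "r < k" by simp
    next
      assume "r < k"
      show "0 < w (e r)"
      proof (rule ccontr)
        assume "\<not> 0 < w (e r)"
        then have "?D \<subseteq> {..<r}" using down that by (force simp: not_le[symmetric])
        then have "k \<le> card {..<r}" unfolding k_def by (intro card_mono) auto
        then show False using \<open>r < k\<close> by simp
      qed
    qed
  qed
  define y where "y = place e (corner k)"
  \<comment> \<open>Positive and negative parts of the sorted weights. \<open>wp\<close> decreases
    and is paired with the slacks of the upper bounds; \<open>wn\<close> increases and is paired
    with those of the lower bounds, so its sum is read from the last row backwards.\<close>
  define wp where "wp = (\<lambda>r. max 0 (w (e r)))"
  define wn where "wn = (\<lambda>r. max 0 (- w (e r)))"
  have inj: "inj_on e R" if "R \<subseteq> {..<CARD('n)}" for R
    using e that bij_betw_imp_inj_on inj_on_subset by blast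
  have ind_image: "ind (e ` R) \<bullet> x = (\<Sum>r\<in>R. x $ e r)" "card (e ` R) = card R"
    if "R \<subseteq> {..<CARD('n)}" for R
    using inj[OF that] by (auto simp: inner_ind sum.reindex card_image)
  have pos: "0 \<le> (\<Sum>r<CARD('n). wp r * (M r - x $ e r))"
  proof (rule sum_antimono_weights_nonneg)
    fix k assume "k \<le> CARD('n)"
    then show "0 \<le> (\<Sum>r<k. M r - x $ e r)"
      using x(2)[of "e ` {..<k}"] ind_image[of "{..<k}"]
      by (simp add: sum_subtractf upper_def)
  next
    show "wp j \<le> wp i" if "i \<le> j" "j < CARD('n)" for i j
      using w[OF that] by (auto simp: wp_def)
  qed (simp add: wp_def)
  have "0 \<le> (\<Sum>r<CARD('n). wn (CARD('n) - Suc r) * (x $ e (CARD('n) - Suc r) - lam ! (CARD('n) - Suc r)))"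
  proof (rule sum_antimono_weights_nonneg)
    fix k assume k: "k \<le> CARD('n)"
    have "(\<Sum>r<k. f (CARD('n) - Suc r)) = (\<Sum>r=CARD('n) - k..<CARD('n). f r)" for f :: "nat \<Rightarrow> real"
      by (rule sum.reindex_bij_witness[of _ "\<lambda>r. CARD('n) - Suc r" "\<lambda>r. CARD('n) - Suc r"])
        (use k in auto)
    from this[of "\<lambda>r. x $ e r - lam ! r"]
    show "0 \<le> (\<Sum>r<k. x $ e (CARD('n) - Suc r) - lam ! (CARD('n) - Suc r))"
      using x(1)[of "e ` {CARD('n) - k..<CARD('n)}"] ind_image[of "{CARD('n) - k..<CARD('n)}"] k
      by (simp add: sum_subtractf lower_def subset_iff)
  next
    show "wn (CARD('n) - Suc j) \<le> wn (CARD('n) - Suc i)" if "i \<le> j" "j < CARD('n)" for i j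
      using w[of "CARD('n) - Suc j" "CARD('n) - Suc i"] that
      by (simp add: wn_def le_max_iff_disj diff_le_mono2) linarith
  qed (simp add: wn_def)
  also have "\<dots> = (\<Sum>r<CARD('n). wn r * (x $ e r - lam ! r))"
    by (rule sum.nat_diff_reindex)
  finally have neg: "0 \<le> (\<Sum>r<CARD('n). wn r * (x $ e r - lam ! r))" .
  have "a \<bullet> x - a \<bullet> y = (\<Sum>i\<in>UNIV. w i * (y $ i - x $ i))"
    by (simp add: inner_vec_def w_def sum_subtractf[symmetric] algebra_simps)
  also have "\<dots> = (\<Sum>r<CARD('n). w (e r) * (y $ e r - x $ e r))"
    by (rule sum.reindex_bij_betw[OF e, symmetric])
  also have "\<dots> = (\<Sum>r<CARD('n). wp r * (M r - x $ e r) + wn r * (x $ e r - lam ! r))"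
  proof (rule sum.cong[OF refl])
    fix r assume "r \<in> {..<CARD('n)}"
    then have r: "r < CARD('n)" by simp
    show "w (e r) * (y $ e r - x $ e r) = wp r * (M r - x $ e r) + wn r * (x $ e r - lam ! r)"
      using k[OF r] place_nth[OF e r, of "corner k"]
      by (auto simp: y_def corner_def wp_def wn_def max_def algebra_simps)
  qed
  also have "\<dots> \<ge> 0"
    using pos neg by (simp add: sum.distrib)
  finally have "a \<bullet> y \<le> a \<bullet> x" by simp
  moreover have "b < a \<bullet> y"
    using ab(2) place_corner_in_P[OF e] y_def by blast
  ultimately show False using ab(1) by simp
qed

lemma lower_0 [simp]: "lower 0 = 0" and upper_0 [simp]: "upper 0 = 0"
  by (simp_all add: lower_def upper_def)

text \<open>Finitely many strict inequalities cut out an open subset of the polytope. The empty set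
  is excluded because both of its bounds are 0.\<close>

lemma interior_P_of_strict_bounds:
  fixes x :: "(real, 'n) vec"
  assumes x: "\<And>S. S \<noteq> {} \<Longrightarrow> lower (card S) < ind S \<bullet> x" "\<And>S. S \<noteq> {} \<Longrightarrow> ind S \<bullet> x < upper (card S)"
  shows "x \<in> interior P"
proof -
  define W where "W = (\<Inter>S\<in>UNIV - {{}}. {y :: (real, 'n) vec. ind S \<bullet> y > lower (card S)} \<inter> {y. ind S \<bullet> y < upper (card S)})"
  have "open W"
    unfolding W_def by (intro open_INT open_Int open_halfspace_lt open_halfspace_gt ballI) auto
  moreover have "W \<subseteq> P"
  proof
    fix y assume y: "y \<in> W"
    have "lower (card S) \<le> ind S \<bullet> y \<and> ind S \<bullet> y \<le> upper (card S)" for S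
    proof (cases "S = {}")
      case True
      then show ?thesis by (simp add: inner_ind)
    next
      case False
      then show ?thesis using y unfolding W_def by (auto simp: less_imp_le)
    qed
    then show "y \<in> P" using in_P_of_bounds by blast
  qed
  moreover have "x \<in> W" using x by (auto simp: W_def)
  ultimately show ?thesis using interior_maximal by blast
qed


subsection \<open>Facets\<close>

text \<open>As \<open>M\<close> is weakly decreasing, the second alternative says that the first
  \<open>s\<close> caps are not all equal. If they are equal, the inequality for a set is the sum of
  those for its elements.\<close>

definition upper_facet :: "nat \<Rightarrow> bool" where
  "upper_facet s \<longleftrightarrow> s = 1 \<or> M (s - 1) < M 0"

text \<open>Each conjunct excludes one redundancy. If the last \<open>s\<close> parts vanish, the
  bound is a sum of bounds \<open>x_i >= 0\<close>; if no earlier row can grow, it follows from the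
  lower bound on the total and the upper bound for the complement.\<close>

definition lower_facet :: "nat \<Rightarrow> bool" where
  "lower_facet s \<longleftrightarrow> (s = 1 \<or> 0 < lam ! (CARD('n) - s)) \<and>
     (s = CARD('n) \<or> (\<exists>r<CARD('n) - s. M r \<noteq> lam ! r))"

lemma place_transpose_diff:
  assumes e: "bij_betw e {..<CARD('n)} UNIV" and a: "a < CARD('n)" and b: "b < CARD('n)" and ab: "a \<noteq> b"
  shows "place e v - place (e \<circ> Transposition.transpose a b) v = (real (v a) - real (v b)) *\<^sub>R (axis (e a) 1 - axis (e b) 1)"
    (is "?l = ?r")
proof -
  have t: "bij_betw (Transposition.transpose a b) {..<CARD('n)} {..<CARD('n)}"
    using a b by (intro permutes_imp_bij permutes_swap_id) auto
  have e': "bij_betw (e \<circ> Transposition.transpose a b) {..<CARD('n)} UNIV"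
    using bij_betw_trans[OF t e] .
  have inj: "e r = e r' \<longleftrightarrow> r = r'" if "r < CARD('n)" "r' < CARD('n)" for r r'
    using bij_betw_imp_inj_on[OF e] that by (auto simp: inj_on_def)
  have "?l $ i = ?r $ i" for i
  proof -
    obtain r where r: "r < CARD('n)" "i = e r"
      using bij_betw_imp_surj_on[OF e] by (metis UNIV_I imageE lessThan_iff)
    have "Transposition.transpose a b r < CARD('n)" using r a b by (auto simp: Transposition.transpose_def)
    from place_nth[OF e' this, of v] have "place (e \<circ> Transposition.transpose a b) v $ i = v (Transposition.transpose a b r)"
      using r by simp
    then show ?thesis
      using r a b ab by (auto simp: place_nth[OF e] inj Transposition.transpose_def axis_def)
  qed
  then show ?thesis by (simp add: vec_eq_iff)
qed

lemma place_diff_at: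
  assumes e: "bij_betw e {..<CARD('n)} UNIV" and b: "b < CARD('n)"
    and v: "\<And>r. r < CARD('n) \<Longrightarrow> r \<noteq> b \<Longrightarrow> v r = v' r"
  shows "place e v - place e v' = (real (v b) - real (v' b)) *\<^sub>R axis (e b) 1"
    (is "?l = ?r")
proof -
  have inj: "e r = e r' \<longleftrightarrow> r = r'" if "r < CARD('n)" "r' < CARD('n)" for r r'
    using bij_betw_imp_inj_on[OF e] that by (auto simp: inj_on_def)
  have "?l $ i = ?r $ i" for i
  proof -
    obtain r where r: "r < CARD('n)" "i = e r"
      using bij_betw_imp_surj_on[OF e] by (metis UNIV_I imageE lessThan_iff)
    then show ?thesis
      using b v[of r] by (auto simp: place_nth[OF e] inj axis_def)
  qed
  then show ?thesis by (simp add: vec_eq_iff)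
qed

text \<open>With the last row placed at \<open>j\<close>, the corners \<open>CARD('n)\<close> and
  \<open>CARD('n) - 1\<close> differ only in coordinate \<open>j\<close>, by the positive last
  cap.\<close>

lemma affine_hull_P: "affine hull P = UNIV"
proof -
  have sub: "P \<subseteq> affine hull P" by (rule hull_subset)
  obtain e where e: "bij_betw e {..<CARD('n)} (UNIV :: 'n set)"
    using finite_same_card_bij[of "{..<CARD('n)}" "UNIV :: 'n set"] by auto
  define a where "a = place e (corner 0)"
  have "x \<in> affine hull P" for x
  proof -
    have "a + (\<Sum>j\<in>UNIV. (x - a) $ j *\<^sub>R axis j 1) \<in> affine hull P"
    proof (rule affine_add_directions)
      fix j :: 'n
      define b where "b = CARD('n) - 1"
      have b: "b < CARD('n)" using m by (simp add: b_def)
      obtain e where e: "bij_betw e {..<CARD('n)} UNIV" "e b = j"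
        using obtain_bij_outside[of "{}" "{}" j b] b by auto
      have "corner CARD('n) r = corner b r" if "r < CARD('n)" "r \<noteq> b" for r
        using that by (auto simp: corner_def b_def)
      moreover have "corner CARD('n) b = M b" "corner b b = 0"
        using lam_last b by (auto simp: corner_def b_def)
      ultimately have "place e (corner CARD('n)) - place e (corner b) = (real (M b) - 0) *\<^sub>R axis j 1"
        using place_diff_at[OF e(1) b, of "corner CARD('n)" "corner b"] e(2) by simp
      then show "\<exists>u\<in>affine hull P. \<exists>v\<in>affine hull P. \<exists>t. t \<noteq> 0 \<and> u - v = t *\<^sub>R axis j 1"
        using place_corner_in_P[OF e(1)] M_pos[of b] sub
        by (intro bexI[of _ "place e (corner CARD('n))"] bexI[of _ "place e (corner b)"]
            exI[of _ "real (M b) - 0"]) auto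
    qed (use place_corner_in_P[OF e] sub in \<open>auto simp: a_def\<close>)
    moreover have "(\<Sum>j\<in>UNIV. (x - a) $ j *\<^sub>R axis j 1) = x - a"
      by (rule vec_eq_sum_axis[symmetric])
    ultimately show ?thesis by simp
  qed
  then show ?thesis by blast
qed

lemma convex_P: "convex P"
  unfolding Newt_def by simp

lemma facet_ofI:
  assumes aff: "affine hull (P \<inter> {x. ind S \<bullet> x = \<beta>}) = {x. ind S \<bullet> x = \<beta>}" and S: "S \<noteq> {}"
    and F: "(P \<inter> {x. ind S \<bullet> x = \<beta>}) face_of P"
  shows "(P \<inter> {x. ind S \<bullet> x = \<beta>}) facet_of P"
proof -
  have "aff_dim (P \<inter> {x. ind S \<bullet> x = \<beta>}) = DIM((real, 'n) vec) - 1"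
    using aff_dim_hyperplane[OF ind_nonzero[OF S], of \<beta>] aff aff_dim_affine_hull by metis
  moreover have "aff_dim P = DIM((real, 'n) vec)"
    using aff_dim_affine_hull[of P] affine_hull_P by simp
  moreover have "{x. ind S \<bullet> x = \<beta>} \<noteq> {}"
    using hyperplane_eq_empty[of "ind S" \<beta>] ind_nonzero[OF S] by auto
  then have "P \<inter> {x. ind S \<bullet> x = \<beta>} \<noteq> {}"
    using aff by auto
  ultimately show ?thesis
    using F by (simp add: facet_of_def)
qed

text \<open>All placements of the rows \<open>T\<close> onto \<open>S\<close> lie on the face.
  Exchanging two unequal rows of \<open>T\<close> gives the directions inside \<open>S\<close>; a
  row \<open>b\<close> outside \<open>T\<close> that grows between \<open>corner b\<close> and
  \<open>corner (Suc b)\<close> gives those outside.\<close>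

lemma affine_hull_placed_face:
  fixes S :: "'n set"
  assumes S: "S \<noteq> {}" and T: "T \<subseteq> {..<CARD('n)}" "card T = card S"
    and on: "(\<Sum>r\<in>T. corner k r) = \<beta>"
    and swap: "card S \<noteq> 1 \<Longrightarrow> \<exists>a\<in>T. \<exists>b\<in>T. corner k a \<noteq> corner k b"
    and free: "card S \<noteq> CARD('n) \<Longrightarrow> \<exists>b<CARD('n). b \<notin> T \<and> M b \<noteq> lam ! b \<and>
      (\<Sum>r\<in>T. corner b r) = \<beta> \<and> (\<Sum>r\<in>T. corner (Suc b) r) = \<beta>"
  shows "affine hull (P \<inter> {x. ind S \<bullet> x = real \<beta>}) = {x. ind S \<bullet> x = real \<beta>}"
proof (rule affine_hull_eq_hyperplane[OF _ _ S])
  have face: "place e (corner k) \<in> P \<inter> {x. ind S \<bullet> x = real \<beta>}"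
    if "bij_betw e {..<CARD('n)} UNIV" "e ` T = S" "(\<Sum>r\<in>T. corner k r) = \<beta>" for e k
    using that(3) place_corner_in_P[OF that(1)] inner_ind_place[OF that(1,2) T(1), of "corner k"] by simp
  show "P \<inter> {x. ind S \<bullet> x = real \<beta>} \<noteq> {}"
    using obtain_bij[OF T] face on by (metis empty_iff)
  show "\<exists>u\<in>P \<inter> {x. ind S \<bullet> x = real \<beta>}. \<exists>v\<in>P \<inter> {x. ind S \<bullet> x = real \<beta>}.
      \<exists>t. t \<noteq> 0 \<and> u - v = t *\<^sub>R (axis i 1 - axis j 1)" if ij: "i \<in> S" "j \<in> S" "i \<noteq> j" for i j
  proof -
    have "card S \<noteq> 1" using ij by (auto simp: card_1_singleton_iff)
    then obtain a b where ab: "a \<in> T" "b \<in> T" "corner k a \<noteq> corner k b" using swap by blast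
    then have "a \<noteq> b" by auto
    obtain e where e: "bij_betw e {..<CARD('n)} UNIV" "e ` T = S" "e a = i" "e b = j"
      using obtain_bij_pair[OF T ij ab(1,2) \<open>a \<noteq> b\<close>] by blast
    have ab': "a < CARD('n)" "b < CARD('n)" using ab T by auto
    have T': "Transposition.transpose a b ` T = T"
      using ab by (intro permutes_image permutes_swap_id)
    have e': "bij_betw (e \<circ> Transposition.transpose a b) {..<CARD('n)} UNIV"
      using ab' by (intro bij_betw_trans[OF _ e(1)] permutes_imp_bij permutes_swap_id) auto
    have "(e \<circ> Transposition.transpose a b) ` T = S" using T' e(2) by (metis image_comp)
    then show ?thesis
      using face[OF e(1,2) on] face[OF e' _ on] place_transpose_diff[OF e(1) ab' \<open>a \<noteq> b\<close>, of "corner k"] e ab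
      by (intro bexI[of _ "place e (corner k)"] bexI[of _ "place (e \<circ> Transposition.transpose a b) (corner k)"]
          exI[of _ "real (corner k a) - real (corner k b)"]) auto
  qed
  show "\<exists>u\<in>P \<inter> {x. ind S \<bullet> x = real \<beta>}. \<exists>v\<in>P \<inter> {x. ind S \<bullet> x = real \<beta>}.
      \<exists>t. t \<noteq> 0 \<and> u - v = t *\<^sub>R axis j 1" if j: "j \<notin> S" for j
  proof -
    have "card S \<noteq> CARD('n)" using j card_subset_eq[of UNIV S] by auto
    then obtain b where b: "b < CARD('n)" "b \<notin> T" "M b \<noteq> lam ! b"
      "(\<Sum>r\<in>T. corner b r) = \<beta>" "(\<Sum>r\<in>T. corner (Suc b) r) = \<beta>"
      using free by blast
    obtain e where e: "bij_betw e {..<CARD('n)} UNIV" "e ` T = S" "e b = j"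
      using obtain_bij_outside[OF T j b(2,1)] by blast
    have "place e (corner (Suc b)) - place e (corner b) = (real (M b) - real (lam ! b)) *\<^sub>R axis j 1"
      using place_diff_at[OF e(1) b(1), of "corner (Suc b)" "corner b"] e(3) by (auto simp: corner_def)
    then show ?thesis
      using face[OF e(1,2) b(4)] face[OF e(1,2) b(5)] b(3)
      by (intro bexI[of _ "place e (corner (Suc b))"] bexI[of _ "place e (corner b)"]
          exI[of _ "real (M b) - real (lam ! b)"]) auto
  qed
qed auto

lemma upper_facet_of:
  fixes S :: "'n set"
  assumes S: "S \<noteq> {}" and good: "upper_facet (card S)"
  defines "H \<equiv> {x. ind S \<bullet> x = real (upper (card S))}"
  shows "(P \<inter> H) facet_of P" "affine hull (P \<inter> H) = H"
proof -
  have s: "0 < card S" "card S \<le> CARD('n)" using S card_le_m by (auto simp: card_gt_0_iff)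
  show aff: "affine hull (P \<inter> H) = H"
    unfolding H_def
  proof (rule affine_hull_placed_face[OF S, where T = "{..<card S}" and k = "CARD('n)"])
    show "\<exists>a\<in>{..<card S}. \<exists>b\<in>{..<card S}. corner CARD('n) a \<noteq> corner CARD('n) b" if "card S \<noteq> 1"
      using that s good by (intro bexI[of _ 0] bexI[of _ "card S - 1"]) (auto simp: upper_facet_def corner_def)
    show "\<exists>b<CARD('n). b \<notin> {..<card S} \<and> M b \<noteq> lam ! b \<and>
      (\<Sum>r<card S. corner b r) = upper (card S) \<and> (\<Sum>r<card S. corner (Suc b) r) = upper (card S)"
      if "card S \<noteq> CARD('n)"
      \<comment> \<open>The last row is free: it lies outside the first \<open>card S\<close> rows
        and grows from 0 to a positive cap.\<close>
      using that s lam_last M_pos[of "CARD('n) - 1"]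
      by (intro exI[of _ "CARD('n) - 1"]) (auto simp: upper_def corner_def intro!: sum.cong)
  qed (use s in \<open>auto simp: upper_def corner_def\<close>)
  show "(P \<inter> H) facet_of P"
    unfolding H_def
    by (rule facet_ofI[OF aff[unfolded H_def] S] face_of_Int_supporting_hyperplane_le convex_P ind_bounds)+
qed

lemma lower_facet_of:
  fixes S :: "'n set"
  assumes S: "S \<noteq> {}" and good: "lower_facet (card S)"
  defines "H \<equiv> {x. ind S \<bullet> x = real (lower (card S))}"
  shows "(P \<inter> H) facet_of P" "affine hull (P \<inter> H) = H"
proof -
  have s: "0 < card S" "card S \<le> CARD('n)" using S card_le_m by (auto simp: card_gt_0_iff)
  show aff: "affine hull (P \<inter> H) = H"
    unfolding H_def
  proof (rule affine_hull_placed_face[OF S, where T = "{CARD('n) - card S..<CARD('n)}" and k = 0])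
    show "\<exists>a\<in>{CARD('n) - card S..<CARD('n)}. \<exists>b\<in>{CARD('n) - card S..<CARD('n)}. corner 0 a \<noteq> corner 0 b"
      if "card S \<noteq> 1"
      using that s good lam_last
      by (intro bexI[of _ "CARD('n) - card S"] bexI[of _ "CARD('n) - 1"]) (auto simp: lower_facet_def corner_def)
    show "\<exists>b<CARD('n). b \<notin> {CARD('n) - card S..<CARD('n)} \<and> M b \<noteq> lam ! b \<and>
      (\<Sum>r=CARD('n) - card S..<CARD('n). corner b r) = lower (card S) \<and>
      (\<Sum>r=CARD('n) - card S..<CARD('n). corner (Suc b) r) = lower (card S)"
      if neq: "card S \<noteq> CARD('n)"
    proof -
      obtain b where "b < CARD('n) - card S" "M b \<noteq> lam ! b"
        using good neq by (auto simp: lower_facet_def)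
      then show ?thesis
        by (intro exI[of _ b]) (auto simp: lower_def corner_def intro!: sum.cong)
    qed
  qed (use s in \<open>auto simp: lower_def corner_def\<close>)
  show "(P \<inter> H) facet_of P"
    unfolding H_def
    by (rule facet_ofI[OF aff[unfolded H_def] S] face_of_Int_supporting_hyperplane_ge convex_P ind_bounds)+
qed

text \<open>Some bound is tight at a relative interior point of \<open>F\<close>, since that point
  is not interior to the polytope; a face containing such a point contains all of
  \<open>F\<close>.\<close>

lemma facet_in_tight:
  assumes F: "F facet_of P"
  shows "\<exists>S. S \<noteq> {} \<and> (F \<subseteq> {x. ind S \<bullet> x = real (upper (card S))} \<or> F \<subseteq> {x. ind S \<bullet> x = real (lower (card S))})"
proof -
  have face: "F face_of P" "F \<noteq> {}" "F \<noteq> P"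
    using F by (auto simp: facet_of_def)
  then have sub: "F \<subseteq> P" and "convex F"
    by (auto simp: face_of_imp_subset face_of_imp_convex)
  then obtain y where y: "y \<in> rel_interior F"
    using face rel_interior_eq_empty by blast
  then have "y \<in> F" using rel_interior_subset by blast
  have "y \<notin> interior P"
    using face_of_disjoint_interior[OF face(1,3)] \<open>y \<in> F\<close> by blast
  then obtain S where S: "S \<noteq> {}" "\<not> (lower (card S) < ind S \<bullet> y \<and> ind S \<bullet> y < upper (card S))"
    using interior_P_of_strict_bounds by blast
  have "y \<in> P" using sub \<open>y \<in> F\<close> by blast
  then consider "ind S \<bullet> y = lower (card S)" | "ind S \<bullet> y = upper (card S)"
    using S(2) ind_bounds[of y S] by fastforce
  then show ?thesis
  proof cases
    case 1
    have "(P \<inter> {x. ind S \<bullet> x = real (lower (card S))}) face_of P"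
      by (rule face_of_Int_supporting_hyperplane_ge convex_P ind_bounds)+
    then have "F \<subseteq> P \<inter> {x. ind S \<bullet> x = real (lower (card S))}"
      by (rule subset_of_face_of) (use sub y \<open>y \<in> P\<close> 1 in auto)
    then show ?thesis using S(1) by blast
  next
    case 2
    have "(P \<inter> {x. ind S \<bullet> x = real (upper (card S))}) face_of P"
      by (rule face_of_Int_supporting_hyperplane_le convex_P ind_bounds)+
    then have "F \<subseteq> P \<inter> {x. ind S \<bullet> x = real (upper (card S))}"
      by (rule subset_of_face_of) (use sub y \<open>y \<in> P\<close> 2 in auto)
    then show ?thesis using S(1) by blast
  qed
qed

lemma upper_1 [simp]: "upper (Suc 0) = lam ! 0"
  by (simp add: upper_def)

lemma lower_1 [simp]: "lower (Suc 0) = 0"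
proof -
  have "{CARD('n) - Suc 0..<CARD('n)} = {CARD('n) - 1}" using m by auto
  then show ?thesis using lam_last by (simp add: lower_def)
qed

text \<open>
  A face on which a redundant inequality is tight also satisfies an irredundant one with equality:
  that of a single coordinate, or that of all coordinates.
\<close>

lemma facet_in_irredundant:
  assumes F: "F facet_of P"
  obtains S where "S \<noteq> {}" "upper_facet (card S)" "F \<subseteq> {x. ind S \<bullet> x = real (upper (card S))}"
  | S where "S \<noteq> {}" "lower_facet (card S)" "F \<subseteq> {x. ind S \<bullet> x = real (lower (card S))}"
proof -
  have sub: "F \<subseteq> P"
    using F by (simp add: facet_of_def face_of_imp_subset)
  have single: "ind {i} \<bullet> x = x $ i" for i and x :: "(real, 'n) vec"
    by (simp add: inner_ind)
  obtain S where S: "S \<noteq> {}" and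
    tight: "F \<subseteq> {x. ind S \<bullet> x = real (upper (card S))} \<or> F \<subseteq> {x. ind S \<bullet> x = real (lower (card S))}"
    using facet_in_tight[OF F] by blast
  obtain i where i: "i \<in> S" using S by blast
  have s: "0 < card S" "card S \<le> CARD('n)" using S card_le_m by (auto simp: card_gt_0_iff)
  from tight show ?thesis
  proof
    assume tight: "F \<subseteq> {x. ind S \<bullet> x = real (upper (card S))}"
    show ?thesis
    proof (cases "upper_facet (card S)")
      case True
      then show ?thesis using that(1) S tight by blast
    next
      case False
      then have "M 0 \<le> M (card S - 1)" by (simp add: upper_facet_def)
      then have "M r = M 0" if "r < card S" for r
      proof -
        have "r \<le> card S - 1" using that by simp
        then show ?thesis
          using \<open>M 0 \<le> M (card S - 1)\<close> cap_antimono[of 0 r h lam] cap_antimono[of r "card S - 1" h lam] by simp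
      qed
      then have U: "upper (card S) = card S * lam ! 0" by (simp add: upper_def)
      have "x $ i = lam ! 0" if x: "x \<in> F" for x
      proof -
        have "(\<Sum>j\<in>S. lam ! 0 - x $ j) = 0"
          using tight x U by (auto simp: inner_ind sum_subtractf subset_iff)
        moreover have "0 \<le> lam ! 0 - x $ j" for j
          using ind_bounds(2)[of x "{j}"] sub x by (auto simp: single)
        ultimately have "\<forall>j\<in>S. lam ! 0 - x $ j = 0"
          by (subst (asm) sum_nonneg_eq_0_iff) auto
        then show ?thesis using i by simp
      qed
      then show ?thesis
        by (intro that(1)[of "{i}"]) (auto simp: upper_facet_def single)
    qed
  next
    assume tight: "F \<subseteq> {x. ind S \<bullet> x = real (lower (card S))}"
    show ?thesis
    proof (cases "lower_facet (card S)")
      case True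
      then show ?thesis using that(2) S tight by blast
    next
      case False
      then have "(card S \<noteq> CARD('n) \<and> (\<forall>r<CARD('n) - card S. M r = lam ! r)) \<or>
          (lam ! (CARD('n) - card S) = 0 \<and> (\<exists>r<CARD('n) - card S. M r \<noteq> lam ! r))"
        using lam_0_pos by (cases "card S = CARD('n)") (auto simp: lower_facet_def)
      then consider (full) "card S \<noteq> CARD('n)" "\<forall>r<CARD('n) - card S. M r = lam ! r"
        | (zero_tail) "lam ! (CARD('n) - card S) = 0" "\<exists>r<CARD('n) - card S. M r \<noteq> lam ! r"
        by (elim disjE conjE)
      then show ?thesis
      proof cases
        case full
        \<comment> \<open>Since the earlier rows cannot grow, the upper bound for the complement is
          the sum of the earlier parts of \<open>lam\<close>. Tightness on \<open>S\<close>
          therefore forces the total down to its minimum |lam|.\<close>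
        have "upper (card (- S)) + lower (card S) = lower CARD('n)"
          using full s sum_lam_split[of "card S"]
          by (simp add: upper_def Compl_eq_Diff_UNIV card_Diff_subset)
        then have total: "real (upper (card (- S))) + real (lower (card S)) = lower CARD('n)"
          by (simp flip: of_nat_add)
        have "ind UNIV \<bullet> x = lower CARD('n)" if x: "x \<in> F" for x
        proof -
          have "ind S \<bullet> x = lower (card S)" using x tight by blast
          moreover have "ind (- S) \<bullet> x \<le> upper (card (- S))" "lower CARD('n) \<le> ind UNIV \<bullet> x"
            using x sub ind_bounds(2)[of x "- S"] ind_bounds(1)[of x UNIV] by blast+
          moreover have "ind UNIV \<bullet> x = ind S \<bullet> x + ind (- S) \<bullet> x"
            using sum_complement[of x S] by (simp add: inner_ind[of UNIV])
          ultimately show ?thesis using total by linarith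
        qed
        then show ?thesis
          using m lam_0_pos by (intro that(2)[of UNIV]) (auto simp: lower_facet_def)
      next
        case zero_tail
        have "lam ! r = 0" if "CARD('n) - card S \<le> r" "r < CARD('n)" for r
          using that zero_tail(1) lam_antimono[of "CARD('n) - card S" r] by simp
        then have L: "lower (card S) = 0" by (simp add: lower_def)
        have "x $ i = 0" if x: "x \<in> F" for x
        proof -
          have "(\<Sum>j\<in>S. x $ j) = 0"
            using tight x L by (auto simp: inner_ind)
          moreover have "0 \<le> x $ j" for j
            using ind_bounds(1)[of x "{j}"] sub x by (auto simp: single)
          ultimately have "\<forall>j\<in>S. x $ j = 0"
            by (subst (asm) sum_nonneg_eq_0_iff) auto
          then show ?thesis using i by simp
        qed
        moreover have "\<exists>r<CARD('n) - 1. M r \<noteq> lam ! r"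
        proof -
          obtain r where "r < CARD('n) - card S" "M r \<noteq> lam ! r" using zero_tail(2) by blast
          then show ?thesis using s by (intro exI[of _ r]) auto
        qed
        ultimately show ?thesis
          by (intro that(2)[of "{i}"]) (auto simp: lower_facet_def single)
      qed
    qed
  qed
qed

subsection \<open>Reflexivity in terms of the partition\<close>

text \<open>At a facet the integer \<open>ind S \<bullet> p\<close> is within one of the bound and
  different from it, and the inequality itself decides the side. Singletons then determine all
  coordinates of \<open>p\<close>.\<close>

lemma reflexive_imp:
  assumes "reflexive P"
  obtains c where "lam ! 0 = c + 1" "lower CARD('n) + 1 = CARD('n) * c"
    "\<And>s. 1 \<le> s \<Longrightarrow> s \<le> CARD('n) \<Longrightarrow> upper_facet s \<Longrightarrow> upper s = s * c + 1"
    "\<And>s. 1 \<le> s \<Longrightarrow> s \<le> CARD('n) \<Longrightarrow> lower_facet s \<Longrightarrow> lower s + 1 = s * c"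
proof -
  obtain p where p: "p \<in> lattice_points" "p \<in> rel_interior P"
    and none: "\<And>F. F facet_of P \<Longrightarrow> lattice_points \<inter> strictly_between p F = {}"
    using assms by (auto simp: reflexive_def affine_hull_P)
  then have "p \<in> P" using rel_interior_subset by blast
  have off: "p \<notin> F" if "F facet_of P" for F
  proof -
    have "F face_of P" "F \<noteq> P" using that by (auto simp: facet_of_def)
    then show ?thesis using p face_of_disjoint_rel_interior[of F P] by auto
  qed
  have int: "ind S \<bullet> p \<in> \<int>" for S
    using p by (auto simp: inner_ind lattice_points_def)
  have near: "x = b + 1 \<or> x = b - 1" if "\<bar>x - b\<bar> \<le> 1" "x \<noteq> b" "x \<in> \<int>" "b \<in> \<int>" for x b :: real
  proof -
    note xb = that
    obtain i j where "x = of_int i" "b = of_int j" using xb(3,4) by (metis Ints_cases)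
    then have "\<bar>i - j\<bar> \<le> 1" "i \<noteq> j" using xb by linarith+
    then have "i = j + 1 \<or> i = j - 1" by linarith
    then show ?thesis using \<open>x = _\<close> \<open>b = _\<close> by auto
  qed
  have up: "ind S \<bullet> p = real (upper (card S)) - 1" if S: "S \<noteq> {}" "upper_facet (card S)" for S
  proof -
    note F = upper_facet_of[OF S]
    have "\<bar>ind S \<bullet> p - upper (card S)\<bar> \<le> 1"
      using lattice_distance_le_1[OF F(2) S(1) p(1) none[OF F(1)]] .
    moreover have "ind S \<bullet> p \<noteq> upper (card S)" using off[OF F(1)] \<open>p \<in> P\<close> by auto
    ultimately show ?thesis
      using near[of "ind S \<bullet> p" "upper (card S)"] int ind_bounds(2)[OF \<open>p \<in> P\<close>, of S] by auto
  qed
  have lo: "ind S \<bullet> p = real (lower (card S)) + 1" if S: "S \<noteq> {}" "lower_facet (card S)" for S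
  proof -
    note F = lower_facet_of[OF S]
    have "\<bar>ind S \<bullet> p - lower (card S)\<bar> \<le> 1"
      using lattice_distance_le_1[OF F(2) S(1) p(1) none[OF F(1)]] .
    moreover have "ind S \<bullet> p \<noteq> lower (card S)" using off[OF F(1)] \<open>p \<in> P\<close> by auto
    ultimately show ?thesis
      using near[of "ind S \<bullet> p" "lower (card S)"] int ind_bounds(1)[OF \<open>p \<in> P\<close>, of S] by auto
  qed
  define c where "c = lam ! 0 - 1"
  have c: "lam ! 0 = c + 1" using lam_0_pos by (simp add: c_def)
  have p_eq: "p $ i = c" for i
    using up[of "{i}"] c by (simp add: upper_facet_def inner_ind)
  have ind_p: "ind S \<bullet> p = card S * c" for S
    by (simp add: inner_ind p_eq)
  have U: "upper s = s * c + 1" if s: "1 \<le> s" "s \<le> CARD('n)" "upper_facet s" for s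
  proof -
    obtain S :: "'n set" where S: "card S = s" using s obtain_subset_with_card_n[of s UNIV] by auto
    then have "S \<noteq> {}" using s by auto
    then have "real (upper s) = real (s * c + 1)" using up[of S] S s ind_p[of S] by simp
    then show ?thesis by (simp only: of_nat_eq_iff)
  qed
  have L: "lower s + 1 = s * c" if s: "1 \<le> s" "s \<le> CARD('n)" "lower_facet s" for s
  proof -
    obtain S :: "'n set" where S: "card S = s" using s obtain_subset_with_card_n[of s UNIV] by auto
    then have "S \<noteq> {}" using s by auto
    then have "real (lower s + 1) = real (s * c)" using lo[of S] S s ind_p[of S] by simp
    then show ?thesis by (simp only: of_nat_eq_iff)
  qed
  \<comment> \<open>The equation for the total is the case \<open>s = CARD('n)\<close>, always a
    lower facet because \<open>lam ! 0\<close> is positive.\<close>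
  show ?thesis
    using that[OF c] U L m lam_0_pos by (simp add: lower_facet_def)
qed

text \<open>The average of the first \<open>s\<close> terms of a weakly decreasing sequence is at
  least the overall average. Strictness for the total thus yields strictness for every
  \<open>s\<close>, as needed for an interior point.\<close>

lemma less_upper_of_mean:
  assumes "CARD('n) * c < upper CARD('n)" "1 \<le> s" "s \<le> CARD('n)"
  shows "s * c < upper s"
proof (rule ccontr)
  assume *: "\<not> s * c < upper s"
  have "s * M (s - 1) \<le> upper s"
  proof -
    have "M (s - 1) \<le> M r" if "r \<in> {..<s}" for r
      using that by (intro cap_antimono) auto
    then show ?thesis
      using sum_bounded_below[of "{..<s}" "M (s - 1)" M] by (simp add: upper_def)
  qed
  then have "s * M (s - 1) \<le> s * c" using * by linarith
  then have "M (s - 1) \<le> c" using assms by simp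
  then have "M r \<le> c" if "s \<le> r" for r
    using le_trans[OF cap_antimono[of "s - 1" r h lam]] that by simp
  then have "(\<Sum>r=s..<CARD('n). M r) \<le> (CARD('n) - s) * c"
    using sum_bounded_above[of "{s..<CARD('n)}" M c] by simp
  moreover have "upper CARD('n) = upper s + (\<Sum>r=s..<CARD('n). M r)"
    using assms unfolding upper_def lessThan_atLeast0 by (simp add: sum.atLeastLessThan_concat)
  moreover have "s * c + (CARD('n) - s) * c = CARD('n) * c"
    unfolding add_mult_distrib[symmetric] using assms by simp
  ultimately show False using * assms by linarith
qed

lemma lower_less_of_mean:
  assumes "lower CARD('n) < CARD('n) * c" "1 \<le> s" "s \<le> CARD('n)"
  shows "lower s < s * c"
proof (rule ccontr)
  assume *: "\<not> lower s < s * c"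
  have "lower s \<le> s * lam ! (CARD('n) - s)"
  proof -
    have "lam ! r \<le> lam ! (CARD('n) - s)" if "r \<in> {CARD('n) - s..<CARD('n)}" for r
      using that by (intro lam_antimono) auto
    then show ?thesis
      using sum_bounded_above[of "{CARD('n) - s..<CARD('n)}" "(!) lam" "lam ! (CARD('n) - s)"] assms(3)
      by (simp add: lower_def)
  qed
  then have "s * c \<le> s * lam ! (CARD('n) - s)" using * by linarith
  then have "c \<le> lam ! (CARD('n) - s)" using assms by simp
  then have "c \<le> lam ! r" if "r < CARD('n) - s" for r
    using le_trans[OF _ lam_antimono[of r "CARD('n) - s"]] that assms by simp
  then have "(CARD('n) - s) * c \<le> (\<Sum>r<CARD('n) - s. lam ! r)"
    using sum_bounded_below[of "{..<CARD('n) - s}" c "(!) lam"] by simp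
  moreover have "s * c + (CARD('n) - s) * c = CARD('n) * c"
    unfolding add_mult_distrib[symmetric] using assms by simp
  ultimately show False using * assms sum_lam_split[of s] by linarith
qed


text \<open>The constant vector with entries \<open>c\<close> is the interior point. The cases
  \<open>s = 1\<close> of \<open>U\<close> and \<open>s = CARD('n)\<close> of \<open>L\<close> are
  already contained in the assumptions on \<open>lam ! 0\<close> and on the total.\<close>

lemma reflexiveI:
  assumes c: "lam ! 0 = c + 1" "lower CARD('n) + 1 = CARD('n) * c" "CARD('n) * c < upper CARD('n)"
    and U: "\<And>s. 2 \<le> s \<Longrightarrow> s \<le> CARD('n) \<Longrightarrow> upper_facet s \<Longrightarrow> upper s = s * c + 1"
    and L: "\<And>s. 1 \<le> s \<Longrightarrow> s < CARD('n) \<Longrightarrow> lower_facet s \<Longrightarrow> lower s + 1 = s * c"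
  shows "reflexive P"
proof -
  define p :: "(real, 'n) vec" where "p = (\<chi> i. real c)"
  have ind_p: "ind S \<bullet> p = real (card S * c)" for S
    by (simp add: inner_ind p_def)
  have card_pos: "1 \<le> card S" if "S \<noteq> {}" for S :: "'n set"
    using that by (simp add: Suc_le_eq card_gt_0_iff)
  have "p \<in> interior P"
  proof (rule interior_P_of_strict_bounds)
    fix S :: "'n set" assume S: "S \<noteq> {}"
    have s: "1 \<le> card S" "card S \<le> CARD('n)" using card_pos[OF S] card_le_m[of S] by simp_all
    show "real (lower (card S)) < ind S \<bullet> p"
      unfolding ind_p of_nat_less_iff by (rule lower_less_of_mean[OF _ s]) (use c(2) in linarith)
    show "ind S \<bullet> p < real (upper (card S))"
      unfolding ind_p of_nat_less_iff by (rule less_upper_of_mean[OF c(3) s])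
  qed
  then have "p \<in> rel_interior P" using interior_subset_rel_interior by blast
  moreover have "p \<in> lattice_points" by (simp add: p_def lattice_points_def)
  moreover have "lattice_points \<inter> strictly_between p F = {}" if F: "F facet_of P" for F
  proof (rule facet_in_irredundant[OF F])
    fix S :: "'n set"
    assume S: "S \<noteq> {}" "upper_facet (card S)" and tight: "F \<subseteq> {x. ind S \<bullet> x = real (upper (card S))}"
    have s: "1 \<le> card S" "card S \<le> CARD('n)" using card_pos[OF S(1)] card_le_m[of S] by simp_all
    have "upper (card S) = card S * c + 1"
    proof (cases "card S = 1")
      case True
      then show ?thesis using c(1) by simp
    next
      case False
      then show ?thesis using U[OF _ s(2) S(2)] s(1) by linarith
    qed
    then have "\<bar>ind S \<bullet> p - real (upper (card S))\<bar> = 1" by (simp add: ind_p)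
    moreover have "affine hull F \<subseteq> {x. ind S \<bullet> x = real (upper (card S))}"
      using tight affine_hyperplane by (rule hull_minimal)
    ultimately show ?thesis
      by (rule no_lattice_points_between[rotated])
  next
    fix S :: "'n set"
    assume S: "S \<noteq> {}" "lower_facet (card S)" and tight: "F \<subseteq> {x. ind S \<bullet> x = real (lower (card S))}"
    have s: "1 \<le> card S" "card S \<le> CARD('n)" using card_pos[OF S(1)] card_le_m[of S] by simp_all
    have "lower (card S) + 1 = card S * c"
    proof (cases "card S = CARD('n)")
      case True
      then show ?thesis using c(2) by metis
    next
      case False
      then show ?thesis using L[OF s(1) _ S(2)] s(2) by linarith
    qed
    then have "real (lower (card S) + 1) = real (card S * c)" by (simp only:)
    then have "\<bar>ind S \<bullet> p - real (lower (card S))\<bar> = 1" by (simp add: ind_p)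
    moreover have "affine hull F \<subseteq> {x. ind S \<bullet> x = real (lower (card S))}"
      using tight affine_hyperplane by (rule hull_minimal)
    ultimately show ?thesis
      by (rule no_lattice_points_between[rotated])
  qed
  ultimately show ?thesis
    unfolding reflexive_def affine_hull_P using lattice_polytope_P by blast
qed

end

subsection \<open>The reflexive cases\<close>

lemma partition_le_2:
  assumes "is_partition xs" "\<forall>x\<in>set xs. x \<le> 2"
  obtains a b z where "xs = replicate a 2 @ replicate b 1 @ replicate z 0"
proof -
  have "\<exists>a b z. xs = replicate a 2 @ replicate b 1 @ replicate z 0"
    using assms
  proof (induction xs)
    case (Cons x xs)
    have "is_partition xs" "\<forall>x\<in>set xs. x \<le> 2"
      using Cons.prems by (simp_all add: is_partition_def)
    then obtain a b z where xs: "xs = replicate a 2 @ replicate b 1 @ replicate z 0"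
      using Cons.IH by blast
    have le: "\<forall>y\<in>set xs. y \<le> x" using Cons.prems by (simp add: is_partition_def)
    have "x \<le> 2" using Cons.prems by simp
    then consider "x = 2" | "x = 1" | "x = 0" by linarith
    then show ?case
    proof cases
      case 1
      then have "x # xs = replicate (Suc a) 2 @ replicate b 1 @ replicate z 0" using xs by simp
      then show ?thesis by blast
    next
      case 2
      then have "2 \<notin> set xs" using le by auto
      then have "a = 0" unfolding xs by simp
      then have "x # xs = replicate 0 2 @ replicate (Suc b) 1 @ replicate z 0" using xs 2 by simp
      then show ?thesis by blast
    next
      case 3
      then have "2 \<notin> set xs" "1 \<notin> set xs" using le by auto
      then have "a = 0" "b = 0" unfolding xs by simp_all
      then have "x # xs = replicate 0 2 @ replicate 0 1 @ replicate (Suc z) 0" using xs 3 by simp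
      then show ?thesis by blast
    qed
  qed simp
  then show ?thesis using that by blast
qed

context partition_data
begin

lemma lower_all: "lower CARD('n) = sum_list lam"
  by (simp add: lower_def sum_list_sum_nth len)

lemma M_le_lam_0: "M r \<le> lam ! 0"
  using cap_antimono[of 0 r h lam] by simp

lemma upper_split_first:
  assumes "1 \<le> k"
  shows "upper k = M 0 + (\<Sum>r=1..<k. M r)"
proof -
  have "{..<k} = insert 0 {1..<k}" using assms by auto
  then show ?thesis by (simp add: upper_def)
qed

text \<open>A cap below 2 can only come from row 1, and then all later caps are 1, so
  \<open>upper s\<close> is \<open>2 + (s - 1)\<close>. For \<open>s > 1\<close> there is no lower
  facet apart from the total: the rows before a positive part are 2, which is already the
  maximum.\<close>

lemma reflexive_twos:
  assumes lam_eq: "lam = replicate a 2 @ replicate b 1 @ replicate (a + 1) 0" and ab: "1 \<le> a" "b \<le> 1"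
  shows "reflexive P"
proof (rule reflexiveI[where c = 1])
  have card: "CARD('n) = 2 * a + b + 1" using len lam_eq by simp
  show 0: "lam ! 0 = 1 + 1" using ab by (simp add: lam_eq nth_append)
  show "lower CARD('n) + 1 = CARD('n) * 1"
  proof -
    have "sum_list lam = 2 * a + b" by (simp add: lam_eq sum_list_replicate)
    then show ?thesis using lower_all card by simp
  qed
  show "CARD('n) * 1 < upper CARD('n)"
  proof -
    have "upper CARD('n) = M 0 + (\<Sum>r=1..<CARD('n). M r)"
      using m by (intro upper_split_first) simp
    moreover have "(CARD('n) - 1) * 1 \<le> (\<Sum>r=1..<CARD('n). M r)"
      using sum_bounded_below[of "{1..<CARD('n)}" 1 M] M_pos by (simp add: Suc_le_eq)
    ultimately show ?thesis using 0 m by simp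
  qed
  show "upper s = s * 1 + 1" if s: "2 \<le> s" "s \<le> CARD('n)" and "upper_facet s" for s
  proof -
    have "\<not> 2 \<le> M (s - 1)" using that 0 by (simp add: upper_facet_def)
    then obtain i where i: "i \<le> s - 1" "lam ! i + h * i \<le> 1"
      unfolding le_cap_iff by (auto simp: not_le)
    have "i \<noteq> 0"
    proof
      assume "i = 0"
      then show False using i(2) 0 by simp
    qed
    moreover have "i \<le> h * i" using h by simp
    ultimately have "i = 1" using i(2) by linarith
    then have "M r \<le> 1" if "1 \<le> r" for r
      using cap_le[of 1 r h lam] i(2) that by simp
    then have M1: "M r = 1" if "1 \<le> r" for r
      using M_pos[of r] that by (metis One_nat_def Suc_leI le_antisym)
    have "upper s = M 0 + (\<Sum>r=1..<s. M r)"
      using s by (intro upper_split_first) simp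
    then show ?thesis using 0 s M1 by simp
  qed
  show "lower s + 1 = s * 1" if s: "1 \<le> s" "s < CARD('n)" and facet: "lower_facet s" for s
  proof (cases "s = 1")
    case False
    then obtain r where r: "0 < lam ! (CARD('n) - s)" "r < CARD('n) - s" "M r \<noteq> lam ! r"
      using facet s by (auto simp: lower_facet_def)
    have "CARD('n) - s < a + b"
    proof (rule ccontr)
      assume *: "\<not> CARD('n) - s < a + b"
      then have "CARD('n) - s - (a + b) < a + 1" using s card by linarith
      then have "lam ! (CARD('n) - s) = 0"
        using * by (simp add: lam_eq nth_append del: replicate_Suc)
      then show False using r(1) by simp
    qed
    then have "r < a" using r(2) ab by simp
    then have "lam ! r = 2" by (simp add: lam_eq nth_append)
    moreover have "r < CARD('n)" using r(2) by linarith
    ultimately have False using r(3) M_le_lam_0[of r] lam_le_M[of r] 0 by simp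
    then show ?thesis ..
  qed simp
qed

lemma M_of_rectangle:
  assumes lam_eq: "lam = replicate (CARD('n) - 1) k @ [0]"
  shows "r < CARD('n) - 1 \<Longrightarrow> M r = k"
    and "M (CARD('n) - 1) = min k (h * (CARD('n) - 1))"
    and "upper CARD('n) = (CARD('n) - 1) * k + M (CARD('n) - 1)"
proof -
  have 0: "lam ! 0 = k" using m by (simp add: lam_eq nth_append)
  show M_init: "M r = k" if "r < CARD('n) - 1" for r
  proof -
    have "lam ! r = k" using that by (simp add: lam_eq nth_append)
    then show ?thesis using M_le_lam_0[of r] lam_le_M[of r] that 0 by simp
  qed
  have "k \<le> lam ! i + h * i" if "i < CARD('n) - 1" for i
    using that by (simp add: lam_eq nth_append)
  then have "min k (h * (CARD('n) - 1)) \<le> lam ! i + h * i" if "i \<le> CARD('n) - 1" for i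
    using that by (cases "i = CARD('n) - 1") (auto simp: min.coboundedI1)
  then have "min k (h * (CARD('n) - 1)) \<le> M (CARD('n) - 1)"
    unfolding le_cap_iff by blast
  moreover have "M (CARD('n) - 1) \<le> h * (CARD('n) - 1)"
    using cap_le[of "CARD('n) - 1" "CARD('n) - 1" h lam] lam_last by simp
  ultimately show "M (CARD('n) - 1) = min k (h * (CARD('n) - 1))"
    using M_le_lam_0[of "CARD('n) - 1"] 0 by simp
  have "{..<CARD('n)} = insert (CARD('n) - 1) {..<CARD('n) - 1}" using m by auto
  then have "upper CARD('n) = M (CARD('n) - 1) + (\<Sum>r<CARD('n) - 1. M r)"
    by (simp add: upper_def)
  also have "(\<Sum>r<CARD('n) - 1. M r) = (CARD('n) - 1) * k"
    using M_init by simp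
  finally show "upper CARD('n) = (CARD('n) - 1) * k + M (CARD('n) - 1)" by simp
qed

lemma reflexive_rectangle:
  assumes lam_eq: "lam = replicate (CARD('n) - 1) (CARD('n) + 1) @ [0]"
    and h_cases: "2 \<le> h \<or> (h = 1 \<and> CARD('n) = 3)"
  shows "reflexive P"
proof (rule reflexiveI[where c = "CARD('n)"])
  note M = M_of_rectangle[OF lam_eq]
  obtain k where k: "CARD('n) = Suc (Suc k)" using m le_Suc_ex[of 2 "CARD('n)"] by auto
  show 0: "lam ! 0 = CARD('n) + 1" using m by (simp add: lam_eq nth_append)
  show "lower CARD('n) + 1 = CARD('n) * CARD('n)"
  proof -
    have "sum_list lam = (CARD('n) - 1) * (CARD('n) + 1)"
      by (subst lam_eq) (simp add: sum_list_replicate)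
    then show ?thesis unfolding lower_all by (simp add: k)
  qed
  have "2 \<le> h * (CARD('n) - 1)"
    using h_cases by (auto simp: k)
  \<comment> \<open>The first rows contribute m^2 - 1 to \<open>upper CARD('n)\<close>, so a last
    cap of at least 2 is what lifts the total above m^2.\<close>
  then have "2 \<le> M (CARD('n) - 1)" unfolding M(2) using m by simp
  then show "CARD('n) * CARD('n) < upper CARD('n)"
    unfolding M(3) by (simp add: k)
  show "upper s = s * CARD('n) + 1" if s: "2 \<le> s" "s \<le> CARD('n)" and facet: "upper_facet s" for s
  proof -
    have less: "M (s - 1) < CARD('n) + 1" using s facet 0 by (simp add: upper_facet_def)
    then have "\<not> s - 1 < CARD('n) - 1" using M(1)[of "s - 1"] by auto
    then have s_eq: "s = CARD('n)" using s by simp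
    then have lt: "h * (CARD('n) - 1) < CARD('n) + 1" and "M (CARD('n) - 1) = h * (CARD('n) - 1)"
      using less M(2) by auto
    \<comment> \<open>The last cap is below m + 1 only for h = 1, m = 3 or for h = 2, m = 2, and the
      product is 2 both times.\<close>
    moreover have "h * (CARD('n) - 1) = 2"
    proof (cases "h = 1")
      case True
      then show ?thesis using h_cases by simp
    next
      case False
      then have "2 \<le> h" using h_cases by simp
      then have "2 * Suc k \<le> h * Suc k" by (rule mult_right_mono) simp
      then have "k = 0" using lt k by simp
      then show ?thesis using \<open>2 \<le> h\<close> lt k by simp
    qed
    ultimately show ?thesis unfolding s_eq M(3) by (simp add: k)
  qed
  show "lower s + 1 = s * CARD('n)" if s: "1 \<le> s" "s < CARD('n)" and facet: "lower_facet s" for s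
  proof -
    obtain r where r: "r < CARD('n) - s" "M r \<noteq> lam ! r"
      using facet s by (auto simp: lower_facet_def)
    then have "r < CARD('n) - 1" using s by simp
    then have "lam ! r = M r" using M(1)[of r] by (simp add: lam_eq nth_append)
    then show ?thesis using r by simp
  qed
qed

lemma reflexive_cases:
  assumes "reflexive P"
  obtains (twos) a b where "1 \<le> a" "b \<le> 1" "lam = replicate a 2 @ replicate b 1 @ replicate (a + 1) 0"
    | (rectangle) "lam = replicate (CARD('n) - 1) (CARD('n) + 1) @ [0]" "2 \<le> h \<or> (h = 1 \<and> CARD('n) = 3)"
proof (rule reflexive_imp[OF assms])
  fix c
  assume c: "lam ! 0 = c + 1" "lower CARD('n) + 1 = CARD('n) * c"
    and U: "\<And>s. 1 \<le> s \<Longrightarrow> s \<le> CARD('n) \<Longrightarrow> upper_facet s \<Longrightarrow> upper s = s * c + 1"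
    and L: "\<And>s. 1 \<le> s \<Longrightarrow> s \<le> CARD('n) \<Longrightarrow> lower_facet s \<Longrightarrow> lower s + 1 = s * c"
  show ?thesis
  proof (cases "c = 1")
    case True
    then have 0: "lam ! 0 = 2" using c by simp
    have "\<forall>x\<in>set lam. x \<le> 2"
      using lam_antimono[of 0] 0 len by (auto simp: in_set_conv_nth)
    then obtain a b z where lam_eq: "lam = replicate a 2 @ replicate b 1 @ replicate z 0"
      using partition_le_2[OF lam] by blast
    have card: "CARD('n) = a + b + z" using len lam_eq by simp
    have a: "1 \<le> a"
    proof (rule ccontr)
      assume "\<not> 1 \<le> a"
      then have "set lam \<subseteq> {0, 1}" by (auto simp: lam_eq)
      moreover have "lam ! 0 \<in> set lam" using len m by simp
      ultimately show False using 0 by auto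
    qed
    have "2 * a + b + 1 = CARD('n)"
    proof -
      have "sum_list lam = 2 * a + b" by (simp add: lam_eq sum_list_replicate)
      then show ?thesis using c(2) True unfolding lower_all by simp
    qed
    then have z: "z = a + 1" using card by simp
    \<comment> \<open>With two parts 1, the first of them, in row \<open>a\<close>, could grow to 2.
      So the bound for the zeros together with the last 1 is a facet, and its equation gives
      \<open>z = 1\<close>, against \<open>z = a + 1\<close>.\<close>
    have "b \<le> 1"
    proof (rule ccontr)
      assume b: "\<not> b \<le> 1"
      have s: "CARD('n) - (z + 1) = a + b - 1" using card b by simp
      have nth: "lam ! r = 1" if "a \<le> r" "r < a + b" for r
        using that by (simp add: lam_eq nth_append)
      have "2 \<le> M a"
        unfolding le_cap_iff
      proof (intro allI impI)
        fix i assume i: "i \<le> a"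
        show "2 \<le> lam ! i + h * i"
        proof (cases "i = a")
          case True
          have "1 * 1 \<le> h * a" using h a by (rule mult_le_mono)
          then show ?thesis using nth[of a] True b by simp
        next
          case False
          then show ?thesis using i by (simp add: lam_eq nth_append)
        qed
      qed
      then have "lower_facet (z + 1)"
        unfolding lower_facet_def s using nth[of "a + b - 1"] nth[of a] b
        by (intro conjI disjI2 exI[of _ a]) auto
      then have "lower (z + 1) + 1 = z + 1"
        using L[of "z + 1"] True card b by simp
      moreover have "lower (z + 1) = 1"
      proof -
        have "lower (z + 1) = lam ! (a + b - 1) + (\<Sum>r=a + b..<CARD('n). lam ! r)"
          unfolding lower_def s using b card by (simp add: sum.atLeast_Suc_lessThan)
        also have "(\<Sum>r=a + b..<CARD('n). lam ! r) = 0"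
          using card by (intro sum.neutral) (auto simp: lam_eq nth_append)
        also have "lam ! (a + b - 1) = 1" using nth b by simp
        finally show ?thesis by simp
      qed
      ultimately show False using z a by simp
    qed
    then show ?thesis using twos[of a b] a lam_eq z by simp
  next
    case False
    \<comment> \<open>The facet \<open>x_i >= 0\<close> would give \<open>0 + 1 = c\<close>. Its
      absence says that no row but the last can grow.\<close>
    then have "\<not> lower_facet 1" using L[of 1] m by auto
    then have eq: "M r = lam ! r" if "r < CARD('n) - 1" for r
      using that by (auto simp: lower_facet_def)
    have init: "lam ! r = c + 1" if r: "r < CARD('n) - 1" for r
    proof (rule ccontr)
      assume "lam ! r \<noteq> c + 1"
      moreover have "lam ! r \<le> lam ! 0"
        by (rule lam_antimono) (use r in auto)
      ultimately have less: "lam ! r < lam ! 0" using c(1) by linarith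
      \<comment> \<open>A part below \<open>lam ! 0\<close> has room for one more cell: row 0 is
        longer by assumption, and every other row up to \<open>r\<close> gains at least one from
        \<open>h * i\<close>.\<close>
      have "lam ! r + 1 \<le> M r"
        unfolding le_cap_iff
      proof (intro allI impI)
        fix i assume i: "i \<le> r"
        show "lam ! r + 1 \<le> lam ! i + h * i"
        proof (cases "i = 0")
          case True
          then show ?thesis using less by simp
        next
          case False
          then have "1 \<le> h * i" using h by simp
          moreover have "lam ! r \<le> lam ! i"
            by (rule lam_antimono) (use i r in auto)
          ultimately show ?thesis by linarith
        qed
      qed
      then show False using eq[OF r] by simp
    qed
    have lam_eq: "lam = replicate (CARD('n) - 1) (c + 1) @ [0]"
    proof (rule nth_equalityI)
      fix i assume "i < length lam"
      then have "i < CARD('n) - 1 \<or> i = CARD('n) - 1" using len by linarith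
      then show "lam ! i = (replicate (CARD('n) - 1) (c + 1) @ [0]) ! i"
        using init[of i] lam_last by (auto simp: nth_append)
    qed (use len m in simp)
    obtain k where k: "CARD('n) = Suc (Suc k)" using m le_Suc_ex[of 2 "CARD('n)"] by auto
    \<comment> \<open>Comparing sizes: (m - 1)(c + 1) + 1 = m c.\<close>
    have "c = CARD('n)"
    proof -
      have "sum_list lam = (CARD('n) - 1) * (c + 1)"
        by (subst lam_eq) (simp add: sum_list_replicate)
      then show ?thesis using c(2) unfolding lower_all by (simp add: k)
    qed
    then have lam_eq: "lam = replicate (CARD('n) - 1) (CARD('n) + 1) @ [0]"
      using lam_eq by simp
    note M = M_of_rectangle[OF this]
    \<comment> \<open>Here the last cap m - 1 is smaller than m + 1, so the upper bound on the total
      is a facet, and (m - 1)(m + 1) + (m - 1) = m^2 + 1 leaves only m = 3.\<close>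
    have "CARD('n) = 3" if "h = 1"
    proof -
      have "M (CARD('n) - 1) = CARD('n) - 1" using M(2) that by simp
      moreover from this have "upper_facet CARD('n)"
        using M(1)[of 0] m by (simp add: upper_facet_def)
      then have "upper CARD('n) = CARD('n) * CARD('n) + 1"
        using U[of "CARD('n)"] m \<open>c = CARD('n)\<close> by simp
      ultimately show ?thesis unfolding M(3) by (simp add: k)
    qed
    then show ?thesis using rectangle[OF lam_eq] h by linarith
  qed
qed

end

theorem theorem4p24:
  fixes m h :: nat and lam :: "nat list"
  assumes "m \<ge> 2" and "CARD('n::{finite,linorder}) = m" and "h \<ge> 1"
    and "is_partition lam" and "length lam = m" and "last lam = 0"
    and "lam \<noteq> replicate m 0"
  shows "reflexive (Newt (G_poly h lam :: 'n int_mpoly)) \<longleftrightarrow>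
      (h \<ge> 1 \<and> odd m \<and> m \<ge> 3 \<and>
         lam = replicate ((m - 1) div 2) 2 @ replicate ((m + 1) div 2) 0)
    \<or> (h \<ge> 1 \<and> even m \<and> m \<ge> 4 \<and>
         lam = replicate ((m - 2) div 2) 2 @ [1] @ replicate (m div 2) 0)
    \<or> (h \<ge> 2 \<and> lam = replicate (m - 1) (m + 1) @ [0])
    \<or> (h = 1 \<and> m = 3 \<and> lam = [4, 4, 0])"
    (is "?refl \<longleftrightarrow> ?odd \<or> ?even \<or> ?rect \<or> ?four")
proof -
  interpret partition_data h lam "TYPE('n)"
    using assms by unfold_locales auto
  have four: "[4, 4, 0] = replicate (3 - 1) (3 + 1) @ [0::nat]"
    by (simp add: numeral_2_eq_2)
  show ?thesis
  proof
    assume ?refl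
    then show "?odd \<or> ?even \<or> ?rect \<or> ?four"
    proof (cases rule: reflexive_cases)
      case (twos a b)
      have m_eq: "m = 2 * a + b + 1" using assms(5) twos(3) by simp
      \<comment> \<open>The number of parts 1 decides the parity of
        \<open>m = 2 * a + b + 1\<close>.\<close>
      consider "b = 0" | "b = 1" using twos(2) by linarith
      then show ?thesis
      proof cases
        case 1
        then have ?odd using m_eq twos assms(3) by simp
        then show ?thesis by blast
      next
        case 2
        then have ?even using m_eq twos assms(3) by simp
        then show ?thesis by blast
      qed
    next
      case rectangle
      then show ?thesis using assms(2) four by auto
    qed
  next
    assume "?odd \<or> ?even \<or> ?rect \<or> ?four"
    then consider ?odd | ?even | ?rect | ?four by blast
    then show ?refl
    proof cases
      case 1
      then obtain a where a: "m = 2 * a + 1" by (auto elim: oddE)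
      show ?thesis
        by (rule reflexive_twos[of a 0]) (use 1 a in auto)
    next
      case 2
      then obtain k where k: "m = 2 * k" by (auto elim: evenE)
      obtain a where a: "k = a + 1" using 2 k by (cases k) auto
      show ?thesis
        by (rule reflexive_twos[of a 1]) (use 2 k a in auto)
    next
      case 3
      then show ?thesis using reflexive_rectangle assms(2) by simp
    next
      case 4
      then show ?thesis using reflexive_rectangle assms(2) four by simp
    qed
  qed
qed

end
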